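(* Let $X^*_e=X^*\times H\rightrightarrows\mathfrak h^*$ be the product groupoid ($H$ being a groupoid over a point), let $J_+=\alpha_X:X\to\mathfrak h^*$, and define $\Psi^-:X^*_e\ast_{J_+}X\to X$ by $$\Psi^-_{(h,p,u,k)}(p,g,q)=\big(\mathrm{Ad}^*_{h^{-1}}p+I^*(u),\ \varphi^-_u(hgk^{-1}),\ \mathrm{Ad}^*_{k^{-1}}q+I^*(\varphi^+_{hgk^{-1}}(u))\big).$$ Then $\Psi^-$ is a left groupoid action of $X^*_e$ on $X$ with moment map $J_+$, and $\Psi^-_{(h,p,u,h)}(p,g,q)=\psi^-_{(h,p,u)}(p,g,q)$ for all $(h,p,u)\in X^*$, $(p,g,q)\in X$, where $$\psi^-_{(h,p,u)}(p,g,q)=\big(\mathrm{Ad}^*_{h^{-1}}p+I^*(u),\ \varphi^-_u(hgh^{-1}),\ \mathrm{Ad}^*_{h^{-1}}q+I^*(\varphi^+_{hgh^{-1}}(u))\big).$$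
   Context: Setting. $G$ is a connected, simply connected Lie group, $H\subset G$ a connected, simply connected Lie subgroup, $\mathfrak g,\mathfrak h$ their Lie algebras, $\iota:\mathfrak h\to\mathfrak g$ the inclusion. $\mathrm{Ad}^*_x,\mathrm{ad}^*_Y$ are the transposes of $\mathrm{Ad}_x,\mathrm{ad}_Y$. $R:\mathfrak g^*\to\mathfrak g$ is linear, skew-symmetric, such that $\kappa(A,B)=-[RA,RB]-R\,\mathrm{ad}^*_{RA}B+R\,\mathrm{ad}^*_{RB}A$ satisfies $\mathrm{ad}_Y\kappa(A,B)+\kappa(\mathrm{ad}^*_YA,B)+\kappa(A,\mathrm{ad}^*_YB)=0$ for $Y\in\mathfrak g$, and $R\,\mathrm{ad}^*_{\iota Z}+\mathrm{ad}_{\iota Z}R=0$ for $Z\in\mathfrak h$. Poisson Lie groups. $G$ with $\{f,g\}_G=\langle R(Df),Dg\rangle-\langle R(D'f),D'g\rangle$ ($\langle Df,Y\rangle=\frac{d}{dt}|_0f(e^{tY}x)$, $\langle D'f,Y\rangle=\frac{d}{dt}|_0f(xe^{tY})$) is a Poisson Lie group; $(G^*,\{\,,\,\}_* )$ is the connected, simply connected dual Poisson Lie group, with Lie algebra $\mathfrak g^*$, $[A,B]_*=\mathrm{ad}^*_{R(A)}B-\mathrm{ad}^*_{R(B)}A$. $\varphi^+$ is the right dressing action of $G$ on $G^*$ and $\varphi^-$ the left dressing action of $G^*$ on $G$, with generators $\lambda^+(Y)(u)=\frac{d}{dt}|_0\varphi^+_{e^{tY}}(u)$, $\lambda^-(A)(x)=\frac{d}{dt}|_0\varphi^-_{e^{tA}}(x)$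 determined by $\{\phi,\psi\}_*(u)=-d\phi(u)\lambda^+(T_1l_u^*d\psi(u))(u)$, $\{f,g\}_G(x)=df(x)\lambda^-(T_1r_x^*dg(x))(x)$. They satisfy $\varphi^+_x(uv)=\varphi^+_{\varphi^-_v(x)}(u)\varphi^+_x(v)$, $\varphi^-_u(xy)=\varphi^-_u(x)\varphi^-_{\varphi^+_x(u)}(y)$, and $\varphi^-_u(h)=h$ for $h\in H$. $G$ is assumed complete, i.e. $\varphi^\pm$ are globally defined. $I^*:G^*\to\mathfrak h^*$ is the ($H$-equivariant) Lie group morphism integrating $\iota^*:\mathfrak g^*\to\mathfrak h^*$. Groupoids. Lie groupoids have target $\alpha$, source $\beta$, unit $\epsilon$; $(x,y)$ composable iff $\beta(x)=\alpha(y)$. $X=\mathfrak h^*\times G\times\mathfrak h^*$: $\alpha_X(p,g,q)=p$, $\beta_X(p,g,q)=q$, $(p,g,q)(q,g',r)=(p,gg',r)$. $X^*=H\times\mathfrak h^*\times G^*$: $\alpha_{X^*}(h,p,u)=\mathrm{Ad}^*_{h^{-1}}p+I^*(u)$, $\beta_{X^*}(h,p,u)=p$, $\epsilon(q)=(1,q,1)$, $(h,\alpha_{X^*}(k,q,v),u)\cdot(k,q,v)=(hk,q,u\varphi^+_{h^{-1}}(v))$. Actions. A left action of $\Gamma\rightrightarrows B$ on $S$ with moment map $f:S\to B$ is a smooth map $\Gamma\ast_fS=\{(x,s)\mid\beta(x)=f(s)\}\to S$, $(x,s)\mapsto x\cdot s$, with $f(x\cdot s)=\alpha(x)$, $y\cdot(x\cdot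 s)=(yx)\cdot s$, $\epsilon(f(t))\cdot t=t$. *)

theory Defs
  imports "HOL-Analysis.Analysis" "HOL-Algebra.Group"
begin

section \<open>Smooth manifolds\<close>

text \<open>
  \<open>Ck_on n S f\<close> is meant for open \<open>S\<close> in a finite-dimensional space: \<open>f\<close> is \<open>C\<^sup>n\<^sup>+\<^sup>1\<close> iff it is
  differentiable and all its directional derivatives are \<open>C\<^sup>n\<close>.  The class \<^class>\<open>euclidean_space\<close> is
  not used because it excludes dimension \<open>0\<close> and has no instance for the dual space
  \<open>'e \<Rightarrow>\<^sub>L real\<close>; finite-dimensionality is demanded in \<open>smooth_manifold\<close> below.
\<close>

primrec Ck_on :: "nat \<Rightarrow> 'a::real_normed_vector set \<Rightarrow> ('a \<Rightarrow> 'b::real_normed_vector) \<Rightarrow> bool" where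
  "Ck_on 0 S f \<longleftrightarrow> continuous_on S f"
| "Ck_on (Suc n) S f \<longleftrightarrow> (\<forall>x\<in>S. f differentiable (at x)) \<and>
     (\<forall>v. Ck_on n S (\<lambda>x. frechet_derivative f (at x) v))"

definition smooth_on :: "'a::real_normed_vector set \<Rightarrow> ('a \<Rightarrow> 'b::real_normed_vector) \<Rightarrow> bool" where
  "smooth_on S f \<longleftrightarrow> (\<forall>n. Ck_on n S f)"

text \<open>A chart is a pair of its domain and its coordinate map; values off the domain are irrelevant.\<close>

type_synonym ('a, 'e) chart = "'a set \<times> ('a \<Rightarrow> 'e)"
type_synonym ('a, 'e) atlas = "('a, 'e) chart set"

definition mcarrier :: "('a, 'e) atlas \<Rightarrow> 'a set" where
  "mcarrier \<A> = (\<Union>(U, f)\<in>\<A>. U)"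

definition mtopology :: "('a, 'e::real_normed_vector) atlas \<Rightarrow> 'a topology" where
  "mtopology \<A> = topology_generated_by {U \<inter> f -` V | U f V. (U, f) \<in> \<A> \<and> open V}"

definition is_atlas :: "('a, 'e::real_normed_vector) atlas \<Rightarrow> bool" where
  "is_atlas \<A> \<longleftrightarrow>
     (\<forall>(U, f)\<in>\<A>. inj_on f U \<and> open (f ` U)) \<and>
     (\<forall>(U, f)\<in>\<A>. \<forall>(V, g)\<in>\<A>. open (f ` (U \<inter> V)) \<and> smooth_on (f ` (U \<inter> V)) (g \<circ> inv_into U f))"

definition smooth_manifold :: "('a, 'e::real_normed_vector) atlas \<Rightarrow> bool" where
  "smooth_manifold \<A> \<longleftrightarrow> is_atlas \<A> \<and> Hausdorff_space (mtopology \<A>) \<and>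
     second_countable (mtopology \<A>) \<and> (\<exists>B :: 'e set. finite B \<and> span B = UNIV)"

text \<open>Smoothness of a map on an open subset \<open>W\<close> of the source manifold.\<close>

definition smooth_map_open ::
  "('a, 'e::real_normed_vector) atlas \<Rightarrow> ('b, 'f::real_normed_vector) atlas \<Rightarrow> 'a set \<Rightarrow> ('a \<Rightarrow> 'b) \<Rightarrow> bool" where
  "smooth_map_open \<A> \<B> W F \<longleftrightarrow>
     continuous_map (subtopology (mtopology \<A>) W) (mtopology \<B>) F \<and>
     (\<forall>(U, f)\<in>\<A>. \<forall>(V, g)\<in>\<B>. smooth_on (f ` (U \<inter> W \<inter> F -` V)) (g \<circ> F \<circ> inv_into U f))"

definition smooth_map ::
  "('a, 'e::real_normed_vector) atlas \<Rightarrow> ('b, 'f::real_normed_vector) atlas \<Rightarrow> ('a \<Rightarrow> 'b) \<Rightarrow> bool" where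
  "smooth_map \<A> \<B> F \<longleftrightarrow> smooth_map_open \<A> \<B> (mcarrier \<A>) F"

text \<open>
  Smoothness on an arbitrary subset, by local smooth extensions.  If the subset is an embedded
  submanifold, this is smoothness for the induced manifold structure.
\<close>

definition smooth_map_on ::
  "('a, 'e::real_normed_vector) atlas \<Rightarrow> ('b, 'f::real_normed_vector) atlas \<Rightarrow> 'a set \<Rightarrow> ('a \<Rightarrow> 'b) \<Rightarrow> bool" where
  "smooth_map_on \<A> \<B> S F \<longleftrightarrow> S \<subseteq> mcarrier \<A> \<and>
     (\<forall>x\<in>S. \<exists>W F'. openin (mtopology \<A>) W \<and> x \<in> W \<and> smooth_map_open \<A> \<B> W F' \<and>
        (\<forall>y\<in>S \<inter> W. F' y = F y))"

definition immersion ::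
  "('a, 'e::real_normed_vector) atlas \<Rightarrow> ('b, 'f::real_normed_vector) atlas \<Rightarrow> ('a \<Rightarrow> 'b) \<Rightarrow> bool" where
  "immersion \<A> \<B> F \<longleftrightarrow> smooth_map \<A> \<B> F \<and>
     (\<forall>(U, f)\<in>\<A>. \<forall>(V, g)\<in>\<B>. \<forall>x\<in>U. F x \<in> V \<longrightarrow>
        (\<exists>D. ((g \<circ> F \<circ> inv_into U f) has_derivative D) (at (f x)) \<and> inj D))"

definition prod_atlas :: "('a, 'e) atlas \<Rightarrow> ('b, 'f) atlas \<Rightarrow> ('a \<times> 'b, 'e \<times> 'f) atlas" where
  "prod_atlas \<A> \<B> = {(U \<times> V, map_prod f g) | U f V g. (U, f) \<in> \<A> \<and> (V, g) \<in> \<B>}"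

definition vec_atlas :: "('e, 'e) atlas" where
  "vec_atlas = {(UNIV, id)}"

definition smooth_fun :: "('a, 'e::real_normed_vector) atlas \<Rightarrow> ('a \<Rightarrow> real) \<Rightarrow> bool" where
  "smooth_fun \<A> \<phi> \<longleftrightarrow> smooth_map \<A> vec_atlas \<phi>"

text \<open>Equality of the tangent vectors of two curves at time \<open>0\<close>.\<close>

definition same_velocity ::
  "('a, 'e::real_normed_vector) atlas \<Rightarrow> (real \<Rightarrow> 'a) \<Rightarrow> (real \<Rightarrow> 'a) \<Rightarrow> bool" where
  "same_velocity \<A> c d \<longleftrightarrow> c 0 \<in> mcarrier \<A> \<and> c 0 = d 0 \<and>
     (\<forall>(U, f)\<in>\<A>. c 0 \<in> U \<longrightarrow>
        (\<exists>v. ((f \<circ> c) has_vector_derivative v) (at 0) \<and> ((f \<circ> d) has_vector_derivative v) (at 0)))"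

definition simply_connected_space :: "'a topology \<Rightarrow> bool" where
  "simply_connected_space T \<longleftrightarrow> path_connected_space T \<and>
     (\<forall>p. continuous_map (top_of_set (sphere (0::complex) 1)) T p \<longrightarrow>
        (\<exists>c. homotopic_with (\<lambda>_. True) (top_of_set (sphere (0::complex) 1)) T p (\<lambda>_. c)))"


section \<open>Lie groups\<close>

text \<open>
  The Lie algebra of a Lie group is the vector space \<open>'e\<close>, on which the group is also modelled.  Its
  identification with the tangent space at the unit is recorded by the exponential map
  \<open>lexp\<close>: \<open>Y\<close> stands for the velocity at \<open>0\<close> of the one-parameter subgroup \<open>t \<mapsto> lexp (tY)\<close>.
  The bracket is not part of the data; it is computed from the group as \<open>[Y, Z] = ad\<^sub>Y Z\<close>.
\<close>

record ('a, 'e) liegrp = "'a monoid" +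
  atlas :: "('a, 'e) atlas"
  lexp :: "'e \<Rightarrow> 'a"

definition is_exponential :: "('a, 'e::real_normed_vector) liegrp \<Rightarrow> bool" where
  "is_exponential G \<longleftrightarrow> smooth_map vec_atlas (atlas G) (lexp G) \<and>
     (\<forall>s t Y. lexp G ((s + t) *\<^sub>R Y) = lexp G (s *\<^sub>R Y) \<otimes>\<^bsub>G\<^esub> lexp G (t *\<^sub>R Y)) \<and>
     (\<forall>(U, f)\<in>atlas G. \<one>\<^bsub>G\<^esub> \<in> U \<longrightarrow> (\<exists>D. ((f \<circ> lexp G) has_derivative D) (at 0) \<and> bij D))"

definition lie_group :: "('a, 'e::real_normed_vector) liegrp \<Rightarrow> bool" where
  "lie_group G \<longleftrightarrow> group G \<and> smooth_manifold (atlas G) \<and> mcarrier (atlas G) = carrier G \<and>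
     smooth_map (prod_atlas (atlas G) (atlas G)) (atlas G) (\<lambda>(x, y). x \<otimes>\<^bsub>G\<^esub> y) \<and>
     smooth_map (atlas G) (atlas G) (\<lambda>x. inv\<^bsub>G\<^esub> x) \<and>
     is_exponential G"

definition connected_simply_connected :: "('a, 'e::real_normed_vector) liegrp \<Rightarrow> bool" where
  "connected_simply_connected G \<longleftrightarrow>
     connected_space (mtopology (atlas G)) \<and> simply_connected_space (mtopology (atlas G))"

text \<open>Lie subgroups are immersed, not necessarily embedded; \<open>H\<close> carries its own manifold structure.\<close>

definition lie_subgroup ::
  "('a, 'f::real_normed_vector) liegrp \<Rightarrow> ('a, 'e::real_normed_vector) liegrp \<Rightarrow> bool" where
  "lie_subgroup H G \<longleftrightarrow> lie_group H \<and> subgroup (carrier H) G \<and> \<one>\<^bsub>H\<^esub> = \<one>\<^bsub>G\<^esub> \<and>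
     (\<forall>x\<in>carrier H. \<forall>y\<in>carrier H. x \<otimes>\<^bsub>H\<^esub> y = x \<otimes>\<^bsub>G\<^esub> y) \<and>
     immersion (atlas H) (atlas G) (\<lambda>x. x)"

definition lie_morphism ::
  "('a, 'e::real_normed_vector) liegrp \<Rightarrow> ('b, 'f::real_normed_vector) liegrp \<Rightarrow> ('a \<Rightarrow> 'b) \<Rightarrow> bool" where
  "lie_morphism K L F \<longleftrightarrow> F \<in> hom K L \<and> smooth_map (atlas K) (atlas L) F"

text \<open>The additive Lie group of a vector space, with Lie algebra the space itself.\<close>

definition vector_liegrp :: "('e::real_normed_vector, 'e) liegrp" where
  "vector_liegrp = \<lparr>carrier = UNIV, mult = (+), one = 0, atlas = vec_atlas, lexp = id\<rparr>"

text \<open>The differential at the unit of a map \<open>F\<close> of Lie groups preserving the unit.\<close>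

definition lie_diff ::
  "('a, 'e::real_normed_vector) liegrp \<Rightarrow> ('b, 'f::real_normed_vector) liegrp \<Rightarrow> ('a \<Rightarrow> 'b) \<Rightarrow> 'e \<Rightarrow> 'f" where
  "lie_diff K L F Y =
     (THE Z. same_velocity (atlas L) (\<lambda>t. F (lexp K (t *\<^sub>R Y))) (\<lambda>t. lexp L (t *\<^sub>R Z)))"

definition Ad :: "('a, 'e::real_normed_vector) liegrp \<Rightarrow> 'a \<Rightarrow> 'e \<Rightarrow> 'e" where
  "Ad G x = lie_diff G G (\<lambda>y. x \<otimes>\<^bsub>G\<^esub> y \<otimes>\<^bsub>G\<^esub> inv\<^bsub>G\<^esub> x)"

definition ad :: "('a, 'e::real_normed_vector) liegrp \<Rightarrow> 'e \<Rightarrow> 'e \<Rightarrow> 'e" where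
  "ad G Y Z = vector_derivative (\<lambda>t. Ad G (lexp G (t *\<^sub>R Y)) Z) (at 0)"

type_synonym 'e dual = "'e \<Rightarrow>\<^sub>L real"

definition transp ::
  "('e::real_normed_vector \<Rightarrow> 'f::real_normed_vector) \<Rightarrow> 'f dual \<Rightarrow> 'e dual" where
  "transp L A = Blinfun (\<lambda>Y. blinfun_apply A (L Y))"

abbreviation Ad_star :: "('a, 'e::real_normed_vector) liegrp \<Rightarrow> 'a \<Rightarrow> 'e dual \<Rightarrow> 'e dual" where
  "Ad_star G x \<equiv> transp (Ad G x)"

abbreviation ad_star :: "('a, 'e::real_normed_vector) liegrp \<Rightarrow> 'e \<Rightarrow> 'e dual \<Rightarrow> 'e dual" where
  "ad_star G Y \<equiv> transp (ad G Y)"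

text \<open>The canonical identification of a finite-dimensional space with its bidual.\<close>

definition unbidual :: "'e::real_normed_vector dual dual \<Rightarrow> 'e" where
  "unbidual \<xi> = (THE Y. \<forall>A. blinfun_apply \<xi> A = blinfun_apply A Y)"


section \<open>Poisson Lie groups\<close>

text \<open>
  \<open>Dr f x\<close> is the pull-back to the unit of \<open>df(x)\<close> along right translation by \<open>x\<close> (the differential
  \<open>D\<close>), and \<open>Dl f x\<close> that along left translation by \<open>x\<close> (the differential \<open>D'\<close>).
\<close>

definition Dr :: "('a, 'e::real_normed_vector) liegrp \<Rightarrow> ('a \<Rightarrow> real) \<Rightarrow> 'a \<Rightarrow> 'e dual" where
  "Dr G f x = Blinfun (\<lambda>Y. deriv (\<lambda>t. f (lexp G (t *\<^sub>R Y) \<otimes>\<^bsub>G\<^esub> x)) 0)"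

definition Dl :: "('a, 'e::real_normed_vector) liegrp \<Rightarrow> ('a \<Rightarrow> real) \<Rightarrow> 'a \<Rightarrow> 'e dual" where
  "Dl G f x = Blinfun (\<lambda>Y. deriv (\<lambda>t. f (x \<otimes>\<^bsub>G\<^esub> lexp G (t *\<^sub>R Y))) 0)"

type_synonym 'a fun_bracket = "('a \<Rightarrow> real) \<Rightarrow> ('a \<Rightarrow> real) \<Rightarrow> 'a \<Rightarrow> real"

text \<open>
  Functions on the manifold are represented by functions on the whole type, so the bracket is
  required to depend only on their values on the manifold.
\<close>

definition poisson_bracket :: "('a, 'e::real_normed_vector) atlas \<Rightarrow> 'a fun_bracket \<Rightarrow> bool" where
  "poisson_bracket \<A> br \<longleftrightarrow>
     (\<forall>f g. smooth_fun \<A> f \<longrightarrow> smooth_fun \<A> g \<longrightarrow> smooth_fun \<A> (br f g)) \<and>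
     (\<forall>f f' g. smooth_fun \<A> f \<longrightarrow> smooth_fun \<A> f' \<longrightarrow> smooth_fun \<A> g \<longrightarrow>
        (\<forall>x\<in>mcarrier \<A>. f x = f' x) \<longrightarrow> (\<forall>x\<in>mcarrier \<A>. br f g x = br f' g x)) \<and>
     (\<forall>f f' g. smooth_fun \<A> f \<longrightarrow> smooth_fun \<A> f' \<longrightarrow> smooth_fun \<A> g \<longrightarrow>
        (\<forall>x\<in>mcarrier \<A>. \<forall>a b. br (\<lambda>z. a * f z + b * f' z) g x = a * br f g x + b * br f' g x)) \<and>
     (\<forall>f g. smooth_fun \<A> f \<longrightarrow> smooth_fun \<A> g \<longrightarrow> (\<forall>x\<in>mcarrier \<A>. br f g x = - br g f x)) \<and>
     (\<forall>f f' g. smooth_fun \<A> f \<longrightarrow> smooth_fun \<A> f' \<longrightarrow> smooth_fun \<A> g \<longrightarrow>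
        (\<forall>x\<in>mcarrier \<A>. br (\<lambda>z. f z * f' z) g x = f x * br f' g x + br f g x * f' x)) \<and>
     (\<forall>f g k. smooth_fun \<A> f \<longrightarrow> smooth_fun \<A> g \<longrightarrow> smooth_fun \<A> k \<longrightarrow>
        (\<forall>x\<in>mcarrier \<A>. br f (br g k) x + br g (br k f) x + br k (br f g) x = 0))"

definition poisson_lie_group :: "('a, 'e::real_normed_vector) liegrp \<Rightarrow> 'a fun_bracket \<Rightarrow> bool" where
  "poisson_lie_group G br \<longleftrightarrow> lie_group G \<and> poisson_bracket (atlas G) br \<and>
     (\<forall>f g. smooth_fun (atlas G) f \<longrightarrow> smooth_fun (atlas G) g \<longrightarrow>
        (\<forall>x\<in>carrier G. \<forall>y\<in>carrier G. br f g (x \<otimes>\<^bsub>G\<^esub> y) =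
           br (\<lambda>z. f (z \<otimes>\<^bsub>G\<^esub> y)) (\<lambda>z. g (z \<otimes>\<^bsub>G\<^esub> y)) x +
           br (\<lambda>z. f (x \<otimes>\<^bsub>G\<^esub> z)) (\<lambda>z. g (x \<otimes>\<^bsub>G\<^esub> z)) y))"

text \<open>The bracket on functions on \<open>G\<close> defined by \<open>R : \<gg>\<^sup>* \<rightarrow> \<gg>\<close>.\<close>

definition R_bracket ::
  "('a, 'e::real_normed_vector) liegrp \<Rightarrow> ('e dual \<Rightarrow> 'e) \<Rightarrow> 'a fun_bracket" where
  "R_bracket G R f g x =
     blinfun_apply (Dr G g x) (R (Dr G f x)) - blinfun_apply (Dl G g x) (R (Dl G f x))"

definition kappa ::
  "('a, 'e::real_normed_vector) liegrp \<Rightarrow> ('e dual \<Rightarrow> 'e) \<Rightarrow> 'e dual \<Rightarrow> 'e dual \<Rightarrow> 'e" where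
  "kappa G R A B = - ad G (R A) (R B) - R (ad_star G (R A) B) + R (ad_star G (R B) A)"

text \<open>
  The dual Poisson Lie group \<open>(G\<^sup>*, {,}\<^sub>*)\<close>: its Lie algebra is \<open>\<gg>\<^sup>*\<close> with the bracket
  \<open>[A, B]\<^sub>* = ad\<^sup>*\<^sub>R\<^sub>A B - ad\<^sup>*\<^sub>R\<^sub>B A\<close>, the linearisation of \<open>R_bracket G R\<close> at the unit, and the linearisation
  of \<open>{,}\<^sub>*\<close> at the unit is the Lie bracket of \<open>\<gg> \<cong> \<gg>\<^sup>*\<^sup>*\<close>, i.e.
  \<open>d\<^sub>1{\<phi>, \<psi>}\<^sub>* = [d\<^sub>1\<phi>, d\<^sub>1\<psi>]\<close>.
\<close>

definition dual_poisson_lie_group ::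
  "('a, 'e::real_normed_vector) liegrp \<Rightarrow> ('e dual \<Rightarrow> 'e) \<Rightarrow> ('b, 'e dual) liegrp \<Rightarrow>
   'b fun_bracket \<Rightarrow> bool" where
  "dual_poisson_lie_group G R Gs brs \<longleftrightarrow>
     poisson_lie_group Gs brs \<and> connected_simply_connected Gs \<and>
     (\<forall>A B. ad Gs A B = ad_star G (R A) B - ad_star G (R B) A) \<and>
     (\<forall>\<phi> \<psi>. smooth_fun (atlas Gs) \<phi> \<longrightarrow> smooth_fun (atlas Gs) \<psi> \<longrightarrow>
        unbidual (Dr Gs (brs \<phi> \<psi>) \<one>\<^bsub>Gs\<^esub>) =
          ad G (unbidual (Dr Gs \<phi> \<one>\<^bsub>Gs\<^esub>)) (unbidual (Dr Gs \<psi> \<one>\<^bsub>Gs\<^esub>)))"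

definition left_lie_action ::
  "('a, 'e::real_normed_vector) liegrp \<Rightarrow> ('s, 'f::real_normed_vector) atlas \<Rightarrow> ('a \<Rightarrow> 's \<Rightarrow> 's) \<Rightarrow> bool" where
  "left_lie_action K \<S> a \<longleftrightarrow>
     smooth_map (prod_atlas (atlas K) \<S>) \<S> (\<lambda>(x, s). a x s) \<and>
     (\<forall>s\<in>mcarrier \<S>. a \<one>\<^bsub>K\<^esub> s = s) \<and>
     (\<forall>x\<in>carrier K. \<forall>y\<in>carrier K. \<forall>s\<in>mcarrier \<S>. a (x \<otimes>\<^bsub>K\<^esub> y) s = a x (a y s))"

definition right_lie_action ::
  "('a, 'e::real_normed_vector) liegrp \<Rightarrow> ('s, 'f::real_normed_vector) atlas \<Rightarrow> ('a \<Rightarrow> 's \<Rightarrow> 's) \<Rightarrow> bool" where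
  "right_lie_action K \<S> a \<longleftrightarrow>
     smooth_map (prod_atlas (atlas K) \<S>) \<S> (\<lambda>(x, s). a x s) \<and>
     (\<forall>s\<in>mcarrier \<S>. a \<one>\<^bsub>K\<^esub> s = s) \<and>
     (\<forall>x\<in>carrier K. \<forall>y\<in>carrier K. \<forall>s\<in>mcarrier \<S>. a (x \<otimes>\<^bsub>K\<^esub> y) s = a y (a x s))"

text \<open>
  In the generator formulas, \<open>d\<phi>(u) \<lambda>\<^sup>+(Y)(u)\<close> is the derivative at \<open>0\<close> of
  \<open>\<phi>(\<phi>\<^sup>+\<^bsub>exp tY\<^esub>(u))\<close>, where \<open>Y = T\<^sub>1l\<^sub>u\<^sup>* d\<psi>(u) \<in> \<gg>\<^sup>*\<^sup>* \<cong> \<gg>\<close>; similarly for \<open>\<lambda>\<^sup>-\<close>, with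
  \<open>A = T\<^sub>1r\<^sub>x\<^sup>* dg(x) \<in> \<gg>\<^sup>*\<close>.  Completeness of \<open>G\<close> is reflected in both actions being global.
\<close>

definition dressing_actions ::
  "('a, 'e::real_normed_vector) liegrp \<Rightarrow> ('e dual \<Rightarrow> 'e) \<Rightarrow> ('b, 'e dual) liegrp \<Rightarrow>
   'b fun_bracket \<Rightarrow> ('a \<Rightarrow> 'b \<Rightarrow> 'b) \<Rightarrow> ('b \<Rightarrow> 'a \<Rightarrow> 'a) \<Rightarrow> bool" where
  "dressing_actions G R Gs brs phip phim \<longleftrightarrow>
     right_lie_action G (atlas Gs) phip \<and> left_lie_action Gs (atlas G) phim \<and>
     (\<forall>\<phi> \<psi>. smooth_fun (atlas Gs) \<phi> \<longrightarrow> smooth_fun (atlas Gs) \<psi> \<longrightarrow> (\<forall>u\<in>carrier Gs.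
        brs \<phi> \<psi> u = - deriv (\<lambda>t. \<phi> (phip (lexp G (t *\<^sub>R unbidual (Dl Gs \<psi> u))) u)) 0)) \<and>
     (\<forall>f g. smooth_fun (atlas G) f \<longrightarrow> smooth_fun (atlas G) g \<longrightarrow> (\<forall>x\<in>carrier G.
        R_bracket G R f g x = deriv (\<lambda>t. f (phim (lexp Gs (t *\<^sub>R Dr G g x)) x)) 0))"


section \<open>The standing setting\<close>

text \<open>
  \<open>\<iota>\<close> is the inclusion \<open>\<hh> \<rightarrow> \<gg>\<close>, the differential of \<open>H \<subseteq> G\<close>.
  Together with the defining data, the locale lists the standard properties of the dressing
  actions (compatibility with the products, and triviality of \<open>\<phi>\<^sup>-\<close> on \<open>H\<close>) and
  the \<open>H\<close>-equivariance of \<open>I\<^sup>*\<close>.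
\<close>

locale poisson_lie_setting =
  fixes G :: "('a, 'g::real_normed_vector) liegrp"
    and H :: "('a, 'h::real_normed_vector) liegrp"
    and R :: "'g dual \<Rightarrow> 'g"
    and Gs :: "('b, 'g dual) liegrp"
    and brs :: "'b fun_bracket"
    and phip :: "'a \<Rightarrow> 'b \<Rightarrow> 'b"
    and phim :: "'b \<Rightarrow> 'a \<Rightarrow> 'a"
    and \<iota> :: "'h \<Rightarrow> 'g"
    and Istar :: "'b \<Rightarrow> 'h dual"
  assumes G: "lie_group G" "connected_simply_connected G"
    and H: "lie_subgroup H G" "connected_simply_connected H"
    and iota: "\<iota> = lie_diff H G (\<lambda>x. x)"
    and R_linear: "linear R"
    and R_skew: "\<And>A B. blinfun_apply B (R A) = - blinfun_apply A (R B)"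
    and kappa_invariant: "\<And>Y A B. ad G Y (kappa G R A B) + kappa G R (ad_star G Y A) B +
      kappa G R A (ad_star G Y B) = 0"
    and R_invariant: "\<And>Z A. R (ad_star G (\<iota> Z) A) + ad G (\<iota> Z) (R A) = 0"
    and dual: "dual_poisson_lie_group G R Gs brs"
    and dressing: "dressing_actions G R Gs brs phip phim"
    and phip_mult: "\<And>x u v. x \<in> carrier G \<Longrightarrow> u \<in> carrier Gs \<Longrightarrow> v \<in> carrier Gs \<Longrightarrow>
      phip x (u \<otimes>\<^bsub>Gs\<^esub> v) = phip (phim v x) u \<otimes>\<^bsub>Gs\<^esub> phip x v"
    and phim_mult: "\<And>u x y. u \<in> carrier Gs \<Longrightarrow> x \<in> carrier G \<Longrightarrow> y \<in> carrier G \<Longrightarrow>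
      phim u (x \<otimes>\<^bsub>G\<^esub> y) = phim u x \<otimes>\<^bsub>G\<^esub> phim (phip x u) y"
    and phim_H: "\<And>u h. u \<in> carrier Gs \<Longrightarrow> h \<in> carrier H \<Longrightarrow> phim u h = h"
    and Istar_morphism: "lie_morphism Gs vector_liegrp Istar"
    and Istar_integrates: "lie_diff Gs vector_liegrp Istar = transp \<iota>"
    and Istar_equivariant: "\<And>h u. h \<in> carrier H \<Longrightarrow> u \<in> carrier Gs \<Longrightarrow>
      Istar (phip h u) = Ad_star H h (Istar u)"


section \<open>Groupoids and their actions\<close>

record ('m, 'em, 'b, 'eb) groupoid =
  arrows :: "('m, 'em) atlas"
  objects :: "('b, 'eb) atlas"
  tgt :: "'m \<Rightarrow> 'b"
  src :: "'m \<Rightarrow> 'b"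
  unit_arrow :: "'b \<Rightarrow> 'm"
  gcomp :: "'m \<Rightarrow> 'm \<Rightarrow> 'm"

text \<open>
  Smoothness of the action is smoothness on the fibre product \<open>\<Gamma> \<ast>\<^sub>f S\<close>, which is an embedded
  submanifold of the product since the source map of a Lie groupoid is a submersion.
\<close>

definition left_groupoid_action ::
  "('m, 'em::real_normed_vector, 'b, 'eb::real_normed_vector) groupoid \<Rightarrow>
   ('s, 'es::real_normed_vector) atlas \<Rightarrow> ('s \<Rightarrow> 'b) \<Rightarrow> ('m \<Rightarrow> 's \<Rightarrow> 's) \<Rightarrow> bool" where
  "left_groupoid_action \<Gamma> \<S> f a \<longleftrightarrow>
     smooth_map \<S> (objects \<Gamma>) f \<and>
     smooth_map_on (prod_atlas (arrows \<Gamma>) \<S>) \<S>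
       {(x, s). x \<in> mcarrier (arrows \<Gamma>) \<and> s \<in> mcarrier \<S> \<and> src \<Gamma> x = f s} (\<lambda>(x, s). a x s) \<and>
     (\<forall>x\<in>mcarrier (arrows \<Gamma>). \<forall>s\<in>mcarrier \<S>. src \<Gamma> x = f s \<longrightarrow> f (a x s) = tgt \<Gamma> x) \<and>
     (\<forall>y\<in>mcarrier (arrows \<Gamma>). \<forall>x\<in>mcarrier (arrows \<Gamma>). \<forall>s\<in>mcarrier \<S>.
        src \<Gamma> y = tgt \<Gamma> x \<longrightarrow> src \<Gamma> x = f s \<longrightarrow> a y (a x s) = a (gcomp \<Gamma> y x) s) \<and>
     (\<forall>s\<in>mcarrier \<S>. a (unit_arrow \<Gamma> (f s)) s = s)"

text \<open>
  The product of a groupoid with a Lie group, the latter seen as a groupoid over a point;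
  the base \<open>B \<times> pt\<close> is identified with \<open>B\<close>.
\<close>

definition groupoid_times_group ::
  "('m, 'em, 'b, 'eb) groupoid \<Rightarrow> ('a, 'e) liegrp \<Rightarrow> ('m \<times> 'a, 'em \<times> 'e, 'b, 'eb) groupoid" where
  "groupoid_times_group \<Gamma> K =
     \<lparr>arrows = prod_atlas (arrows \<Gamma>) (atlas K), objects = objects \<Gamma>,
      tgt = (\<lambda>(x, k). tgt \<Gamma> x), src = (\<lambda>(x, k). src \<Gamma> x),
      unit_arrow = (\<lambda>b. (unit_arrow \<Gamma> b, \<one>\<^bsub>K\<^esub>)),
      gcomp = (\<lambda>(x, k) (y, l). (gcomp \<Gamma> x y, k \<otimes>\<^bsub>K\<^esub> l))\<rparr>"

definition X_groupoid ::
  "('a, 'g) liegrp \<Rightarrow>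
   ('h::real_normed_vector dual \<times> 'a \<times> 'h dual, 'h dual \<times> 'g \<times> 'h dual, 'h dual, 'h dual) groupoid" where
  "X_groupoid G =
     \<lparr>arrows = prod_atlas vec_atlas (prod_atlas (atlas G) vec_atlas), objects = vec_atlas,
      tgt = (\<lambda>(p, g, q). p), src = (\<lambda>(p, g, q). q),
      unit_arrow = (\<lambda>p. (p, \<one>\<^bsub>G\<^esub>, p)),
      gcomp = (\<lambda>(p, g, q) (q', g', r). (p, g \<otimes>\<^bsub>G\<^esub> g', r))\<rparr>"

definition Xstar_groupoid ::
  "('a, 'h::real_normed_vector) liegrp \<Rightarrow> ('b, 'gs) liegrp \<Rightarrow> ('a \<Rightarrow> 'b \<Rightarrow> 'b) \<Rightarrow> ('b \<Rightarrow> 'h dual) \<Rightarrow>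
   ('a \<times> 'h dual \<times> 'b, 'h \<times> 'h dual \<times> 'gs, 'h dual, 'h dual) groupoid" where
  "Xstar_groupoid H Gs phip Istar =
     \<lparr>arrows = prod_atlas (atlas H) (prod_atlas vec_atlas (atlas Gs)), objects = vec_atlas,
      tgt = (\<lambda>(h, p, u). Ad_star H (inv\<^bsub>H\<^esub> h) p + Istar u), src = (\<lambda>(h, p, u). p),
      unit_arrow = (\<lambda>q. (\<one>\<^bsub>H\<^esub>, q, \<one>\<^bsub>Gs\<^esub>)),
      gcomp = (\<lambda>(h, p, u) (k, q, v). (h \<otimes>\<^bsub>H\<^esub> k, q, u \<otimes>\<^bsub>Gs\<^esub> phip (inv\<^bsub>H\<^esub> h) v))\<rparr>"

text \<open>
  Both maps below are relevant only where the source of the arrow equals the first component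
  of the point.
\<close>

definition Psi_minus ::
  "('a, 'g::real_normed_vector) liegrp \<Rightarrow> ('a, 'h::real_normed_vector) liegrp \<Rightarrow>
   ('a \<Rightarrow> 'b \<Rightarrow> 'b) \<Rightarrow> ('b \<Rightarrow> 'a \<Rightarrow> 'a) \<Rightarrow> ('b \<Rightarrow> 'h dual) \<Rightarrow>
   ('a \<times> 'h dual \<times> 'b) \<times> 'a \<Rightarrow> 'h dual \<times> 'a \<times> 'h dual \<Rightarrow> 'h dual \<times> 'a \<times> 'h dual" where
  "Psi_minus G H phip phim Istar = (\<lambda>((h, p, u), k) (_, g, q).
     (Ad_star H (inv\<^bsub>H\<^esub> h) p + Istar u,
      phim u (h \<otimes>\<^bsub>G\<^esub> g \<otimes>\<^bsub>G\<^esub> inv\<^bsub>G\<^esub> k),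
      Ad_star H (inv\<^bsub>H\<^esub> k) q + Istar (phip (h \<otimes>\<^bsub>G\<^esub> g \<otimes>\<^bsub>G\<^esub> inv\<^bsub>G\<^esub> k) u)))"

definition psi_minus ::
  "('a, 'g::real_normed_vector) liegrp \<Rightarrow> ('a, 'h::real_normed_vector) liegrp \<Rightarrow>
   ('a \<Rightarrow> 'b \<Rightarrow> 'b) \<Rightarrow> ('b \<Rightarrow> 'a \<Rightarrow> 'a) \<Rightarrow> ('b \<Rightarrow> 'h dual) \<Rightarrow>
   'a \<times> 'h dual \<times> 'b \<Rightarrow> 'h dual \<times> 'a \<times> 'h dual \<Rightarrow> 'h dual \<times> 'a \<times> 'h dual" where
  "psi_minus G H phip phim Istar = (\<lambda>(h, p, u) (_, g, q).
     (Ad_star H (inv\<^bsub>H\<^esub> h) p + Istar u,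
      phim u (h \<otimes>\<^bsub>G\<^esub> g \<otimes>\<^bsub>G\<^esub> inv\<^bsub>G\<^esub> h),
      Ad_star H (inv\<^bsub>H\<^esub> h) q + Istar (phip (h \<otimes>\<^bsub>G\<^esub> g \<otimes>\<^bsub>G\<^esub> inv\<^bsub>G\<^esub> h) u)))"

end

theory Submission
  imports Defs
begin

text \<open>
  The algebraic part of the statement rests on two identities.  For \<open>h, k \<in> H\<close>, \<open>m \<in> G\<close> and
  \<open>u, v \<in> G\<^sup>*\<close>, put \<open>w = \<phi>\<^sup>+\<close> of \<open>h\<^sup>-\<^sup>1\<close> applied to \<open>v\<close>, so that the dressing action of \<open>h\<close> takes \<open>w\<close> back
  to \<open>v\<close>.  Since \<open>\<phi>\<^sup>-\<close> fixes \<open>H\<close> pointwise, the twisted product rule for \<open>\<phi>\<^sup>-\<close> gives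
  \<open>\<phi>\<^sup>-\<^sub>w(h m k) = h \<phi>\<^sup>-\<^sub>v(m) k\<close> (\<open>phim_biequivariant\<close>), and inserting this into the twisted product rule
  for \<open>\<phi>\<^sup>+\<close> shows that \<open>h m k\<close> maps the product \<open>u w\<close> to the product of the image of \<open>u\<close> under
  \<open>h \<phi>\<^sup>-\<^sub>v(m) k\<close> and the image of \<open>v\<close> under \<open>m\<close> followed by \<open>k\<close> (\<open>phip_biequivariant\<close>).  The element
  \<open>u w\<close> is the \<open>G\<^sup>*\<close>-component of a product in \<open>X\<^sup>*\<close>.  The first identity is therefore compatibility of
  \<open>\<Psi>\<^sup>-\<close> with the multiplication in the component \<open>G\<close> of \<open>X\<close>.  The second, after applying the
  \<open>H\<close>-equivariant morphism \<open>I\<^sup>*\<close>, is compatibility in the last component, because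
  \<open>h \<mapsto> Ad\<^sup>*\<close> of \<open>h\<^sup>-\<^sup>1\<close> is a linear left action of \<open>H\<close>.  The units act trivially since
  \<open>\<phi>\<^sup>+\<^sub>x(1)\<close> is idempotent in \<open>G\<^sup>*\<close>, hence equal to \<open>1\<close>.

  For smoothness, the formula for \<open>\<Psi>\<^sup>-\<close> makes sense, and is smooth, on the whole product manifold
  and not only on the fibre product.  It is assembled from the group operations, the dressing actions,
  \<open>I\<^sup>*\<close>, and the map \<open>(h, p) \<mapsto> Ad\<^sup>*\<^sub>h p\<close>, so what has to be shown is that the last one is well behaved.
  A differential of a map of Lie groups is defined by a description operator, as the \<open>Z\<close> whose
  one-parameter subgroup has the same velocity as a given curve.  Let \<open>g\<close> be a chart at the unit.  By
  hypothesis \<open>g \<circ> exp\<close> has a bijective derivative \<open>D\<close> at \<open>0\<close>, so this \<open>Z\<close> exists, is unique, and is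
  \<open>D\<^sup>-\<^sup>1\<close> of the velocity read off in the chart (\<open>lie_diff_chart\<close>).  In particular
  \<open>Ad\<^sub>h Y = D\<^sup>-\<^sup>1 (d/dt g(h exp(tY) h\<^sup>-\<^sup>1))\<close> at \<open>t = 0\<close>, a partial derivative of a smooth function of
  \<open>(h, t)\<close>, which is smooth in \<open>h\<close> (\<open>Ad_smooth\<close>).  Expanding in a basis of \<open>\<hh>\<close> then gives smoothness of
  \<open>Ad\<^sup>*\<close> (\<open>Ad_star_smooth\<close>).

  Both arguments need that smooth maps compose.  Smoothness of a function is expressed by iterated
  directional derivatives, and the chain rule for these uses a finite basis of the intermediate space
  with continuous coordinates (\<open>Ck_on_compose\<close>).  Smoothness of a map of manifolds, a condition on all
  charts and on the topologies, is equivalent to smoothness near each point in one pair of charts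
  (\<open>smooth_map_iff_smooth_at\<close>), and in this form it is stable under composition and pairing.
\<close>

section \<open>Finite-dimensional normed spaces\<close>

definition finite_dimensional :: "'e::real_normed_vector itself \<Rightarrow> bool" where
  "finite_dimensional _ \<longleftrightarrow> (\<exists>B :: 'e set. finite B \<and> span B = UNIV)"

text \<open>
  Compactness of the unit sphere of the maximum norm on coordinate vectors: the norm of the linear
  combination is continuous and, by independence, nonzero there, so it has a positive minimum \<open>m\<close>,
  and \<open>1 / m\<close> serves as the bound.  Coordinate vectors are functions on the whole type that
  vanish off \<open>B\<close>, so that Tychonoff's theorem applies to the product topology.
\<close>

lemma independent_coordinates_bounded:
  fixes B :: "'e::real_normed_vector set"
  assumes B: "finite B" "independent B"
  shows "\<exists>K. \<forall>c. \<forall>b\<in>B. \<bar>c b\<bar> \<le> K * norm (\<Sum>b\<in>B. c b *\<^sub>R b)"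
proof (cases "B = {}")
  case False
  define S where "S = PiE UNIV (\<lambda>b. if b \<in> B then {-1..1::real} else {0})"
  define T where "T = S \<inter> (\<Union>b\<in>B. {c. \<bar>c b\<bar> = 1})"
  have "compactin (product_topology (\<lambda>_. euclidean) UNIV) S"
    unfolding S_def compactin_PiE by auto
  hence S: "compact S"
    by (simp add: euclidean_product_topology)
  have coord: "continuous_on UNIV (\<lambda>c :: 'e \<Rightarrow> real. c b)" for b
    by (simp add: continuous_on_product_coordinates)
  have "closed {c :: 'e \<Rightarrow> real. \<bar>c b\<bar> = 1}" for b
    by (intro closed_Collect_eq continuous_intros coord)
  hence T: "compact T"
    unfolding T_def using B S by (intro compact_Int_closed closed_UN) auto
  obtain b0 where b0: "b0 \<in> B"
    using False by blast
  have "(\<lambda>b. if b = b0 then 1 else 0) \<in> T"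
    using b0 by (auto simp: T_def S_def PiE_def Pi_def)
  hence ne: "T \<noteq> {}" by blast
  have cont: "continuous_on T (\<lambda>c. norm (\<Sum>b\<in>B. c b *\<^sub>R b))"
    by (intro continuous_intros continuous_on_subset[OF coord]) auto
  obtain c0 where c0: "c0 \<in> T" and min: "\<And>c. c \<in> T \<Longrightarrow>
      norm (\<Sum>b\<in>B. c0 b *\<^sub>R b) \<le> norm (\<Sum>b\<in>B. c b *\<^sub>R b)"
    using continuous_attains_inf[OF T ne cont] by blast
  define m where "m = norm (\<Sum>b\<in>B. c0 b *\<^sub>R b)"
  have "m \<noteq> 0"
  proof
    assume "m = 0"
    hence "(\<Sum>b\<in>B. c0 b *\<^sub>R b) = 0" by (simp add: m_def)
    hence "\<forall>b\<in>B. c0 b = 0"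
      using B independentD by blast
    thus False using c0 by (auto simp: T_def)
  qed
  hence m: "m > 0" by (simp add: m_def)
  have "\<bar>c b\<bar> \<le> (1 / m) * norm (\<Sum>b\<in>B. c b *\<^sub>R b)" if b: "b \<in> B" for c b
  proof -
    define M where "M = Max ((\<lambda>b. \<bar>c b\<bar>) ` B)"
    have M: "\<bar>c b\<bar> \<le> M" if "b \<in> B" for b
      unfolding M_def using B that by (intro Max_ge) auto
    show ?thesis
    proof (cases "M = 0")
      case True
      thus ?thesis using M[OF b] m by simp
    next
      case False
      hence Mpos: "M > 0" using M[OF b] by linarith
      have "M \<in> (\<lambda>b. \<bar>c b\<bar>) ` B"
        unfolding M_def using B \<open>B \<noteq> {}\<close> by (intro Max_in) auto
      then obtain b1 where b1: "b1 \<in> B" "\<bar>c b1\<bar> = M" by auto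
      \<comment> \<open>normalised to maximum norm \<open>1\<close>\<close>
      define d where "d = (\<lambda>b. if b \<in> B then c b / M else 0)"
      have "d \<in> S"
      proof -
        have "- 1 \<le> c b / M \<and> c b / M \<le> 1" if "b \<in> B" for b
          using M[OF that] Mpos by (simp add: pos_le_divide_eq pos_divide_le_eq abs_le_iff)
        thus ?thesis unfolding S_def d_def by (auto simp: PiE_def Pi_def)
      qed
      hence "d \<in> T" using b1 Mpos by (auto simp: T_def d_def)
      from min[OF this] have "m \<le> norm (\<Sum>b\<in>B. d b *\<^sub>R b)" by (simp add: m_def)
      also have "(\<Sum>b\<in>B. d b *\<^sub>R b) = (1 / M) *\<^sub>R (\<Sum>b\<in>B. c b *\<^sub>R b)"
        unfolding scaleR_sum_right by (rule sum.cong) (auto simp: d_def)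
      finally have "m * M \<le> norm (\<Sum>b\<in>B. c b *\<^sub>R b)"
        using Mpos by (simp add: field_simps)
      moreover have "m * \<bar>c b\<bar> \<le> m * M" using M[OF b] m by simp
      ultimately have "m * \<bar>c b\<bar> \<le> norm (\<Sum>b\<in>B. c b *\<^sub>R b)" by (rule order_trans[rotated])
      thus ?thesis using m by (simp add: pos_le_divide_eq mult.commute)
    qed
  qed
  thus ?thesis by blast
qed auto

lemma finite_dimensional_coordinates:
  assumes "finite_dimensional TYPE('e::real_normed_vector)"
  obtains B :: "'e::real_normed_vector set" and c :: "'e \<Rightarrow> 'e \<Rightarrow> real"
  where "finite B" "\<And>b. bounded_linear (c b)" "\<And>v. (\<Sum>b\<in>B. c b v *\<^sub>R b) = v"
proof -
  obtain B0 :: "'e set" where B0: "finite B0" "span B0 = UNIV"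
    using assms by (auto simp: finite_dimensional_def)
  obtain B where B: "B \<subseteq> B0" "independent B" "B0 \<subseteq> span B"
    using maximal_independent_subset[of B0] by blast
  have fin: "finite B" using B B0 finite_subset by blast
  have sp: "span B = UNIV" using B B0 by (metis span_mono span_span top.extremum_uniqueI)
  have eq: "(\<Sum>b\<in>B. representation B v b *\<^sub>R b) = v" for v
    using sum_representation_eq[of B v B] B fin sp by auto
  obtain K where K: "\<And>c b. b \<in> B \<Longrightarrow> \<bar>c b\<bar> \<le> K * norm (\<Sum>b\<in>B. c b *\<^sub>R b)"
    using independent_coordinates_bounded[OF fin B(2)] by blast
  have bl: "bounded_linear (\<lambda>v. representation B v b)" for b
  proof (rule bounded_linear_intro[where K = "max K 0"])
    show "norm (representation B v b) \<le> norm v * max K 0" for v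
    proof (cases "b \<in> B")
      case True
      have "\<bar>representation B v b\<bar> \<le> K * norm v"
        using K[OF True, of "representation B v"] by (simp add: eq)
      also have "K * norm v \<le> max K 0 * norm v" by (intro mult_right_mono) auto
      finally show ?thesis by (simp add: mult.commute)
    next
      case False
      thus ?thesis using representation_ne_zero[of B v b] by fastforce
    qed
  qed (use B sp in \<open>auto simp: representation_add representation_scale\<close>)
  show ?thesis by (rule that[of B "\<lambda>b v. representation B v b"]) (auto simp: fin bl eq)
qed

lemma finite_dimensional_bounded_linear:
  fixes L :: "'e::real_normed_vector \<Rightarrow> 'f::real_normed_vector"
  assumes "finite_dimensional TYPE('e)" "linear L"
  shows "bounded_linear L"
proof -
  obtain B :: "'e set" and c where B: "finite B" "\<And>b. bounded_linear (c b)"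
      "\<And>v. (\<Sum>b\<in>B. c b v *\<^sub>R b) = v"
    using finite_dimensional_coordinates[OF assms(1)] by metis
  have "L = (\<lambda>v. \<Sum>b\<in>B. c b v *\<^sub>R L b)"
  proof
    fix v
    have "L v = L (\<Sum>b\<in>B. c b v *\<^sub>R b)" by (simp add: B)
    also have "\<dots> = (\<Sum>b\<in>B. c b v *\<^sub>R L b)"
      by (simp add: linear_sum[OF assms(2)] linear_cmul[OF assms(2)])
    finally show "L v = (\<Sum>b\<in>B. c b v *\<^sub>R L b)" .
  qed
  thus ?thesis
    using bounded_linear_sum[of B "\<lambda>b v. c b v *\<^sub>R L b"] B(2)
    by (simp add: bounded_linear_scaleR_const)
qed

lemma finite_dimensional_real: "finite_dimensional TYPE(real)"
proof -
  have "x \<in> span {1}" for x :: real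
    using span_scale[OF span_base[of 1 "{1::real}"], of x] by simp
  hence "span {1::real} = UNIV" by blast
  thus ?thesis unfolding finite_dimensional_def by blast
qed

lemma finite_dimensional_prod:
  assumes "finite_dimensional TYPE('e::real_normed_vector)"
    and "finite_dimensional TYPE('f::real_normed_vector)"
  shows "finite_dimensional TYPE('e \<times> 'f)"
proof -
  obtain B :: "'e set" where B: "finite B" "span B = UNIV"
    using assms(1) by (auto simp: finite_dimensional_def)
  obtain C :: "'f set" where C: "finite C" "span C = UNIV"
    using assms(2) by (auto simp: finite_dimensional_def)
  let ?i = "\<lambda>x. (x, 0) :: 'e \<times> 'f" and ?j = "\<lambda>y. (0, y) :: 'e \<times> 'f"
  let ?D = "?i ` B \<union> ?j ` C"
  have "linear ?i" "linear ?j" by (auto intro!: linearI)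
  hence "span (?i ` B) = range ?i" "span (?j ` C) = range ?j"
    using linear_span_image B(2) C(2) by metis+
  hence "range ?i \<subseteq> span ?D" "range ?j \<subseteq> span ?D"
    using span_mono[of "?i ` B" ?D] span_mono[of "?j ` C" ?D] by auto
  hence "(x, 0) + (0, y) \<in> span ?D" for x y
    by (intro span_add) auto
  hence "span ?D = UNIV" by auto
  thus ?thesis unfolding finite_dimensional_def using B C by (intro exI[of _ ?D]) auto
qed

text \<open>
  The coordinate functionals of a basis span the dual.
\<close>

lemma finite_dimensional_dual:
  assumes "finite_dimensional TYPE('e::real_normed_vector)"
  shows "finite_dimensional TYPE('e dual)"
proof -
  obtain B :: "'e set" and c where B: "finite B" "\<And>b. bounded_linear (c b)"
      "\<And>v. (\<Sum>b\<in>B. c b v *\<^sub>R b) = v"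
    using finite_dimensional_coordinates[OF assms] by metis
  have "A = (\<Sum>b\<in>B. blinfun_apply A b *\<^sub>R Blinfun (c b))" for A
  proof (rule blinfun_eqI)
    fix v
    have "blinfun_apply A v = blinfun_apply A (\<Sum>b\<in>B. c b v *\<^sub>R b)" by (simp add: B)
    also have "\<dots> = blinfun_apply (\<Sum>b\<in>B. blinfun_apply A b *\<^sub>R Blinfun (c b)) v"
      unfolding blinfun.sum_right blinfun.sum_left
      by (simp add: blinfun.bilinear_simps
          bounded_linear_Blinfun_apply B mult.commute)
    finally show "blinfun_apply A v =
        blinfun_apply (\<Sum>b\<in>B. blinfun_apply A b *\<^sub>R Blinfun (c b)) v" .
  qed
  moreover have "(\<Sum>b\<in>B. blinfun_apply A b *\<^sub>R Blinfun (c b)) \<in> span ((\<lambda>b. Blinfun (c b)) ` B)" for A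
    by (intro span_sum span_scale span_base) auto
  ultimately have "span ((\<lambda>b. Blinfun (c b)) ` B) = UNIV" by (metis UNIV_eq_I)
  thus ?thesis unfolding finite_dimensional_def using B(1) by blast
qed

section \<open>Calculus of smooth functions\<close>

lemma Ck_on_subset: "Ck_on n S f \<Longrightarrow> T \<subseteq> S \<Longrightarrow> Ck_on n T f"
proof (induction n arbitrary: f)
  case 0
  thus ?case using continuous_on_subset by auto
next
  case (Suc n)
  thus ?case by (metis Ck_on.simps(2) subsetD)
qed

lemma Ck_on_cong:
  assumes "open S" "\<And>x. x \<in> S \<Longrightarrow> f x = g x"
  shows "Ck_on n S f \<longleftrightarrow> Ck_on n S g"
  using assms(2)
proof (induction n arbitrary: f g)
  case 0
  thus ?case by (auto cong: continuous_on_cong)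
next
  case (Suc n)
  hence der: "(f has_derivative D) (at x) \<longleftrightarrow> (g has_derivative D) (at x)" if "x \<in> S" for x D
    using has_derivative_transform_within_open[OF _ assms(1) that, of f D UNIV g]
      has_derivative_transform_within_open[OF _ assms(1) that, of g D UNIV f] Suc.prems by metis
  hence "f differentiable (at x) \<longleftrightarrow> g differentiable (at x)" if "x \<in> S" for x
    using that by (auto simp: differentiable_def)
  moreover have "frechet_derivative f (at x) = frechet_derivative g (at x)" if "x \<in> S" for x
    using that der by (simp add: frechet_derivative_def)
  hence "Ck_on n S (\<lambda>x. frechet_derivative f (at x) v) \<longleftrightarrow>
         Ck_on n S (\<lambda>x. frechet_derivative g (at x) v)" for v
    by (intro Suc.IH) auto
  ultimately show ?case by simp
qed

lemma Ck_on_SucI: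
  assumes "open S" "\<And>x. x \<in> S \<Longrightarrow> (f has_derivative f' x) (at x)"
    and "\<And>v. Ck_on n S (\<lambda>x. f' x v)"
  shows "Ck_on (Suc n) S f"
proof -
  have "Ck_on n S (\<lambda>x. frechet_derivative f (at x) v) \<longleftrightarrow> Ck_on n S (\<lambda>x. f' x v)" for v
    using frechet_derivative_at[OF assms(2)] by (intro Ck_on_cong assms(1)) auto
  thus ?thesis using assms by (auto simp: differentiable_def)
qed

lemma Ck_on_SucD:
  assumes "Ck_on (Suc n) S f"
  shows "\<And>x. x \<in> S \<Longrightarrow> (f has_derivative frechet_derivative f (at x)) (at x)"
    and "\<And>v. Ck_on n S (\<lambda>x. frechet_derivative f (at x) v)"
  using assms by (auto simp: frechet_derivative_works)

lemma Ck_on_Suc_imp: "Ck_on (Suc n) S f \<Longrightarrow> Ck_on n S f"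
proof (induction n arbitrary: f)
  case 0
  thus ?case
    by (auto intro!: continuous_at_imp_continuous_on differentiable_imp_continuous_within)
next
  case (Suc n)
  have "Ck_on n S (\<lambda>x. frechet_derivative f (at x) v)" for v
    by (rule Suc.IH) (use Suc.prems Ck_on.simps(2)[of "Suc n"] in blast)
  thus ?case using Suc.prems Ck_on.simps(2) by blast
qed

lemma Ck_on_local:
  "(\<And>x. x \<in> S \<Longrightarrow> \<exists>T. open T \<and> x \<in> T \<and> Ck_on n T f) \<Longrightarrow> Ck_on n S f"
proof (induction n arbitrary: f)
  case 0
  have "isCont f x" if "x \<in> S" for x
    using 0[OF that] continuous_on_eq_continuous_at by auto
  thus ?case by (simp add: continuous_at_imp_continuous_on)
next
  case (Suc n)
  have "Ck_on n S (\<lambda>x. frechet_derivative f (at x) v)" for v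
    by (rule Suc.IH) (use Suc.prems in force)
  thus ?case using Suc.prems by force
qed

lemma Ck_on_const: "open S \<Longrightarrow> Ck_on n S (\<lambda>x. c)"
proof (induction n arbitrary: c)
  case (Suc n)
  show ?case by (rule Ck_on_SucI[where f' = "\<lambda>_ _. 0"]) (use Suc in auto)
qed auto

lemma Ck_on_bounded_linear: "open S \<Longrightarrow> bounded_linear L \<Longrightarrow> Ck_on n S L"
proof (cases n)
  case (Suc m)
  assume *: "open S" "bounded_linear L"
  show ?thesis unfolding Suc
    by (rule Ck_on_SucI[where f' = "\<lambda>_. L"])
       (use * in \<open>auto intro: Ck_on_const bounded_linear_imp_has_derivative\<close>)
qed (auto simp: linear_continuous_on)

lemma Ck_on_add:
  "open S \<Longrightarrow> Ck_on n S f \<Longrightarrow> Ck_on n S g \<Longrightarrow> Ck_on n S (\<lambda>x. f x + g x)"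
proof (induction n arbitrary: f g)
  case (Suc n)
  note f = Ck_on_SucD[OF Suc.prems(2)] and g = Ck_on_SucD[OF Suc.prems(3)]
  show ?case
    by (rule Ck_on_SucI) (use Suc.prems(1) f g in \<open>auto intro!: Suc.IH has_derivative_add\<close>)
qed (auto intro: continuous_on_add)

lemma Ck_on_sum:
  assumes "open S" "\<And>i. i \<in> I \<Longrightarrow> Ck_on n S (f i)"
  shows "Ck_on n S (\<lambda>x. \<Sum>i\<in>I. f i x)"
  using assms(2)
  by (induction I rule: infinite_finite_induct)
     (auto intro!: Ck_on_const Ck_on_add assms(1))

lemma Ck_on_compose_bounded_linear:
  assumes "bounded_linear L"
  shows "open S \<Longrightarrow> Ck_on n S f \<Longrightarrow> Ck_on n S (\<lambda>x. L (f x))"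
proof (induction n arbitrary: f)
  case 0
  thus ?case using assms by (auto intro: bounded_linear.continuous_on)
next
  case (Suc n)
  note f = Ck_on_SucD[OF Suc.prems(2)]
  show ?case
    by (rule Ck_on_SucI)
       (use Suc.prems(1) f in \<open>auto intro!: Suc.IH bounded_linear.has_derivative[OF assms]\<close>)
qed

lemma Ck_on_bounded_bilinear:
  assumes "bounded_bilinear pr"
  shows "open S \<Longrightarrow> Ck_on n S f \<Longrightarrow> Ck_on n S g \<Longrightarrow> Ck_on n S (\<lambda>x. pr (f x) (g x))"
proof (induction n arbitrary: f g)
  case 0
  thus ?case using assms by (auto intro: bounded_bilinear.continuous_on)
next
  case (Suc n)
  note f = Ck_on_SucD[OF Suc.prems(2)] and g = Ck_on_SucD[OF Suc.prems(3)]
  note fg = Suc.prems(2,3)[THEN Ck_on_Suc_imp]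
  show ?case
    by (rule Ck_on_SucI)
       (use Suc.prems(1) f g fg in
         \<open>auto intro!: Suc.IH Ck_on_add bounded_bilinear.FDERIV[OF assms]\<close>)
qed

lemma Ck_on_Pair:
  assumes "open S" "Ck_on n S f" "Ck_on n S g"
  shows "Ck_on n S (\<lambda>x. (f x, g x))"
proof -
  have "bounded_linear (\<lambda>x. (x, 0))" "bounded_linear (\<lambda>x. (0, x))"
    by (intro bounded_linear_Pair bounded_linear_ident bounded_linear_zero)+
  hence "Ck_on n S (\<lambda>x. (f x, 0))" "Ck_on n S (\<lambda>x. (0, g x))"
    using Ck_on_compose_bounded_linear[OF _ assms(1)] assms(2,3) by blast+
  from Ck_on_add[OF assms(1) this] have "Ck_on n S (\<lambda>x. (f x, 0) + (0, g x))" .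
  thus ?thesis by simp
qed

text \<open>
  By the chain rule, the directional derivative of \<open>g \<circ> f\<close> along \<open>v\<close> is \<open>g'(f x)(f'(x) v)\<close>, in which
  the direction of differentiation of \<open>g\<close> varies with \<open>x\<close>.  Expanding \<open>f'(x) v\<close> in a basis turns it
  into a finite sum of products of coordinates of \<open>f'(x) v\<close> with derivatives of \<open>g\<close> in fixed
  directions, to which the induction hypothesis applies.
\<close>

lemma Ck_on_compose:
  fixes f :: "'d::real_normed_vector \<Rightarrow> 'e::real_normed_vector"
  assumes fd: "finite_dimensional TYPE('e)"
    and S: "open S" and T: "open T" and img: "f ` S \<subseteq> T"
  shows "Ck_on n S f \<Longrightarrow> Ck_on n T g \<Longrightarrow> Ck_on n S (\<lambda>x. g (f x))"
proof (induction n arbitrary: g)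
  case 0
  thus ?case using img by (auto intro: continuous_on_compose2)
next
  case (Suc n)
  note f = Ck_on_SucD[OF Suc.prems(1)] and g = Ck_on_SucD[OF Suc.prems(2)]
  obtain B :: "'e set" and c where B: "finite B" "\<And>b. bounded_linear (c b)"
      "\<And>v. (\<Sum>b\<in>B. c b v *\<^sub>R b) = v"
    using finite_dimensional_coordinates[OF fd] by metis
  let ?f' = "\<lambda>x. frechet_derivative f (at x)" and ?g' = "\<lambda>y. frechet_derivative g (at y)"
  let ?D = "\<lambda>x v. \<Sum>b\<in>B. c b (?f' x v) *\<^sub>R ?g' (f x) b"
  show ?case
  proof (rule Ck_on_SucI[OF S])
    fix x assume x: "x \<in> S"
    have "((\<lambda>x. g (f x)) has_derivative (\<lambda>v. ?g' (f x) (?f' x v))) (at x)"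
      using has_derivative_compose[OF f(1)[OF x] g(1)] x img by auto
    moreover have "?g' (f x) (?f' x v) = ?D x v" for v
    proof -
      have "linear (?g' (f x))" using g(1) x img by (blast intro: has_derivative_linear)
      hence "?g' (f x) (\<Sum>b\<in>B. c b (?f' x v) *\<^sub>R b) = ?D x v"
        by (simp add: linear_sum linear_cmul)
      thus ?thesis by (simp only: B(3))
    qed
    ultimately show "((\<lambda>x. g (f x)) has_derivative ?D x) (at x)" by simp
  next
    fix v
    show "Ck_on n S (\<lambda>x. ?D x v)"
      by (intro Ck_on_sum S Ck_on_bounded_bilinear[OF bounded_bilinear_scaleR]
          Ck_on_compose_bounded_linear[OF B(2)] f(2) Suc.IH[OF _ g(2)])
         (rule Ck_on_Suc_imp[OF Suc.prems(1)])
  qed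
qed

lemma smooth_on_cong: "open S \<Longrightarrow> (\<And>x. x \<in> S \<Longrightarrow> f x = g x) \<Longrightarrow> smooth_on S f \<longleftrightarrow> smooth_on S g"
  using Ck_on_cong unfolding smooth_on_def by blast

lemma smooth_on_subset: "smooth_on S f \<Longrightarrow> T \<subseteq> S \<Longrightarrow> smooth_on T f"
  using Ck_on_subset unfolding smooth_on_def by blast

lemma smooth_on_local:
  assumes "\<And>x. x \<in> S \<Longrightarrow> \<exists>T. open T \<and> x \<in> T \<and> smooth_on T f"
  shows "smooth_on S f"
  unfolding smooth_on_def
proof
  fix n
  show "Ck_on n S f"
  proof (rule Ck_on_local)
    fix x assume "x \<in> S"
    then obtain T where "open T" "x \<in> T" "smooth_on T f" using assms by metis
    thus "\<exists>T. open T \<and> x \<in> T \<and> Ck_on n T f" unfolding smooth_on_def by metis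
  qed
qed

lemma smooth_on_compose:
  fixes f :: "'d::real_normed_vector \<Rightarrow> 'e::real_normed_vector"
  assumes "finite_dimensional TYPE('e)" "open S" "open T" "\<And>x. x \<in> S \<Longrightarrow> f x \<in> T"
    and "smooth_on S f" "smooth_on T g"
  shows "smooth_on S (\<lambda>x. g (f x))"
proof -
  have "f ` S \<subseteq> T" using assms(4) by blast
  thus ?thesis using Ck_on_compose[OF assms(1-3)] assms(5,6) unfolding smooth_on_def by blast
qed

lemma smooth_on_bounded_linear: "open S \<Longrightarrow> bounded_linear L \<Longrightarrow> smooth_on S L"
  by (simp add: smooth_on_def Ck_on_bounded_linear)

lemma smooth_on_Pair:
  "open S \<Longrightarrow> smooth_on S f \<Longrightarrow> smooth_on S g \<Longrightarrow> smooth_on S (\<lambda>x. (f x, g x))"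
  by (simp add: smooth_on_def Ck_on_Pair)

lemma smooth_on_bounded_bilinear:
  "bounded_bilinear pr \<Longrightarrow> open S \<Longrightarrow> smooth_on S f \<Longrightarrow> smooth_on S g \<Longrightarrow>
    smooth_on S (\<lambda>x. pr (f x) (g x))"
  by (simp add: smooth_on_def Ck_on_bounded_bilinear)

lemma smooth_on_continuous: "smooth_on S f \<Longrightarrow> continuous_on S f"
  unfolding smooth_on_def by (metis Ck_on.simps(1))

lemma smooth_on_frechet_derivative:
  assumes "smooth_on S f"
  shows "x \<in> S \<Longrightarrow> (f has_derivative frechet_derivative f (at x)) (at x)"
    and "smooth_on S (\<lambda>x. frechet_derivative f (at x) v)"
proof -
  have "Ck_on (Suc n) S f" for n using assms unfolding smooth_on_def by blast
  from Ck_on_SucD[OF this]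
  show "x \<in> S \<Longrightarrow> (f has_derivative frechet_derivative f (at x)) (at x)"
    and "smooth_on S (\<lambda>x. frechet_derivative f (at x) v)"
    unfolding smooth_on_def by blast+
qed

section \<open>Smoothness in charts\<close>

text \<open>
  The part of the axioms of a manifold that smoothness of maps depends on.  Unlike
  \<open>smooth_manifold\<close>, it passes to products and vector spaces without topological work.
\<close>

definition findim_atlas :: "('a, 'e::real_normed_vector) atlas \<Rightarrow> bool" where
  "findim_atlas \<A> \<longleftrightarrow> is_atlas \<A> \<and> finite_dimensional TYPE('e)"

lemma findim_atlas_smooth_manifold: "smooth_manifold \<A> \<Longrightarrow> findim_atlas \<A>"
  by (simp add: findim_atlas_def smooth_manifold_def finite_dimensional_def)

lemma atlasD:
  assumes "findim_atlas \<A>" "(U, f) \<in> \<A>"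
  shows "inj_on f U" "open (f ` U)"
    and "(V, g) \<in> \<A> \<Longrightarrow> open (f ` (U \<inter> V))"
    and "(V, g) \<in> \<A> \<Longrightarrow> smooth_on (f ` (U \<inter> V)) (\<lambda>y. g (inv_into U f y))"
proof -
  have *: "case c of (U, f) \<Rightarrow> inj_on f U \<and> open (f ` U)" if "c \<in> \<A>" for c
    using assms(1) that unfolding findim_atlas_def is_atlas_def by blast
  have **: "case d of (V, g) \<Rightarrow> open (f ` (U \<inter> V)) \<and> smooth_on (f ` (U \<inter> V)) (g \<circ> inv_into U f)"
    if "d \<in> \<A>" for d
    using assms that unfolding findim_atlas_def is_atlas_def by blast
  show "inj_on f U" "open (f ` U)"
    using *[OF assms(2)] by auto
  show "(V, g) \<in> \<A> \<Longrightarrow> open (f ` (U \<inter> V))"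
    and "(V, g) \<in> \<A> \<Longrightarrow> smooth_on (f ` (U \<inter> V)) (\<lambda>y. g (inv_into U f y))"
    using **[of "(V, g)"] by (auto simp: o_def)
qed

lemma topspace_mtopology: "topspace (mtopology \<A>) = mcarrier \<A>"
proof -
  let ?S = "{U \<inter> f -` V | U f V. (U, f) \<in> \<A> \<and> open V}"
  have "U \<in> ?S" if "(U, f) \<in> \<A>" for U f
    by (rule CollectI, rule exI[of _ U], rule exI[of _ f], rule exI[of _ UNIV]) (simp add: that)
  hence "mcarrier \<A> \<subseteq> \<Union> ?S" unfolding mcarrier_def by blast
  moreover have "\<Union> ?S \<subseteq> mcarrier \<A>" unfolding mcarrier_def by blast
  ultimately show ?thesis
    unfolding mtopology_def topology_generated_by_topspace by (rule equalityI[rotated])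
qed

lemma mcarrierI: "(U, f) \<in> \<A> \<Longrightarrow> x \<in> U \<Longrightarrow> x \<in> mcarrier \<A>"
  unfolding mcarrier_def by auto

lemma mcarrierE:
  assumes "x \<in> mcarrier \<A>"
  obtains U f where "(U, f) \<in> \<A>" "x \<in> U"
  using assms unfolding mcarrier_def by auto

lemma openin_chart_preimage:
  "(U, f) \<in> \<A> \<Longrightarrow> open V \<Longrightarrow> openin (mtopology \<A>) (U \<inter> f -` V)"
  unfolding mtopology_def by (rule topology_generated_by_Basis) blast

text \<open>
  The topology is generated by the sets \<open>U' \<inter> f' -` V\<close>.  Under a chart \<open>f\<close> the image of such a set is the
  preimage of \<open>V\<close> under a transition map, and injectivity of \<open>f\<close> makes images commute with
  intersections.
\<close>

lemma open_chart_image: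
  assumes A: "findim_atlas \<A>" and U: "(U, f) \<in> \<A>" and T: "openin (mtopology \<A>) T"
  shows "open (f ` (T \<inter> U))"
proof -
  note inj = atlasD(1)[OF A U]
  have "generate_topology_on {U \<inter> f -` V | U f V. (U, f) \<in> \<A> \<and> open V} T"
    using T unfolding mtopology_def openin_topology_generated_by_iff .
  thus ?thesis
  proof induction
    case (Int a b)
    have "f ` ((a \<inter> b) \<inter> U) = f ` (a \<inter> U) \<inter> f ` (b \<inter> U)"
      using inj_on_image_Int[OF inj, of "a \<inter> U" "b \<inter> U"] by (simp add: Int_ac)
    thus ?case using Int by (simp only: open_Int)
  next
    case (UN K)
    have "f ` (\<Union> K \<inter> U) = (\<Union>k\<in>K. f ` (k \<inter> U))" by blast
    thus ?case using UN open_UN[of K "\<lambda>k. f ` (k \<inter> U)"] by metis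
  next
    case (Basis s)
    then obtain U' f' V where s: "s = U' \<inter> f' -` V" "(U', f') \<in> \<A>" "open V" by blast
    have "f ` (s \<inter> U) = f ` (U \<inter> U') \<inter> (\<lambda>y. f' (inv_into U f y)) -` V"
      unfolding s using inj by (auto simp: inj_on_def image_iff)
    thus ?case
      using continuous_open_preimage[OF smooth_on_continuous[OF atlasD(4)[OF A U s(2)]]
          atlasD(3)[OF A U s(2)] s(3)] by simp
  qed simp
qed

text \<open>
  The coordinate representation \<open>g \<circ> F \<circ> f\<^sup>-\<^sup>1\<close> is defined and smooth near \<open>f x\<close>.  The neighbourhood
  \<open>N\<close> is kept inside the image of the chart, where \<open>inv_into U f\<close> is meaningful.
\<close>

definition smooth_in_charts ::
  "'a set \<Rightarrow> ('a \<Rightarrow> 'e::real_normed_vector) \<Rightarrow> 'b set \<Rightarrow> ('b \<Rightarrow> 'f::real_normed_vector) \<Rightarrow> ('a \<Rightarrow> 'b) \<Rightarrow> 'a \<Rightarrow> bool"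
  where
  "smooth_in_charts U f V g F x \<longleftrightarrow> x \<in> U \<and> (\<exists>N. open N \<and> f x \<in> N \<and> N \<subseteq> f ` U \<and>
     (\<forall>y\<in>N. F (inv_into U f y) \<in> V) \<and> smooth_on N (\<lambda>y. g (F (inv_into U f y))))"

lemma smooth_in_charts_compose:
  fixes g :: "'b \<Rightarrow> 'f::real_normed_vector"
  assumes fd: "finite_dimensional TYPE('f)" and f: "inj_on f U" and g: "inj_on g V"
    and F: "smooth_in_charts U f V g F x" and G: "smooth_in_charts V g W h G (F x)"
  shows "smooth_in_charts U f W h (\<lambda>x. G (F x)) x"
proof -
  let ?i = "inv_into U f" and ?j = "inv_into V g"
  obtain M where M: "x \<in> U" "open M" "f x \<in> M" "M \<subseteq> f ` U" "\<And>y. y \<in> M \<Longrightarrow> F (?i y) \<in> V"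
      "smooth_on M (\<lambda>y. g (F (?i y)))"
    using F unfolding smooth_in_charts_def by blast
  obtain N where N: "open N" "g (F x) \<in> N" "N \<subseteq> g ` V" "\<And>y. y \<in> N \<Longrightarrow> G (?j y) \<in> W"
      "smooth_on N (\<lambda>y. h (G (?j y)))"
    using G unfolding smooth_in_charts_def by blast
  \<comment> \<open>the points whose image lies where the representation of \<open>G\<close> is smooth\<close>
  let ?L = "M \<inter> (\<lambda>y. g (F (?i y))) -` N"
  have L: "open ?L"
    using continuous_open_preimage[OF smooth_on_continuous[OF M(6)] M(2) N(1)] .
  have eq: "?j (g (F (?i y))) = F (?i y)" if "y \<in> M" for y
    using M(5)[OF that] g by simp
  have "smooth_on ?L (\<lambda>y. h (G (?j (g (F (?i y))))))"
    by (rule smooth_on_compose[OF fd L N(1) _ smooth_on_subset[OF M(6)] N(5)]) auto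
  hence sm: "smooth_on ?L (\<lambda>y. h (G (F (?i y))))"
    using smooth_on_cong[OF L, of "\<lambda>y. h (G (?j (g (F (?i y)))))" "\<lambda>y. h (G (F (?i y)))"] eq
    by auto
  have "f x \<in> ?L" using M N f by simp
  moreover have "G (F (?i y)) \<in> W" if "y \<in> ?L" for y
    using that N(4)[of "g (F (?i y))"] eq by simp
  moreover have "?L \<subseteq> f ` U" using M(4) by blast
  ultimately show ?thesis
    unfolding smooth_in_charts_def using L sm M(1) by blast
qed

text \<open>
  Compatibility of charts is smoothness of the identity; change of charts thus becomes a special case of
  composition.
\<close>

lemma smooth_in_charts_transition:
  assumes "findim_atlas \<A>" "(U, f) \<in> \<A>" "(V, g) \<in> \<A>" "x \<in> U" "x \<in> V"
  shows "smooth_in_charts U f V g (\<lambda>x. x) x"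
  unfolding smooth_in_charts_def
proof (intro conjI exI[of _ "f ` (U \<inter> V)"])
  show "\<forall>y\<in>f ` (U \<inter> V). inv_into U f y \<in> V"
    using atlasD(1)[OF assms(1,2)] by auto
  show "smooth_on (f ` (U \<inter> V)) (\<lambda>y. g (inv_into U f y))" "open (f ` (U \<inter> V))"
    using atlasD(3,4)[OF assms(1-3)] by blast+
qed (use assms in blast)+

definition smooth_at ::
  "('a, 'e::real_normed_vector) atlas \<Rightarrow> ('b, 'f::real_normed_vector) atlas \<Rightarrow> ('a \<Rightarrow> 'b) \<Rightarrow> 'a \<Rightarrow> bool"
  where
  "smooth_at \<A> \<B> F x \<longleftrightarrow> (\<exists>(U, f)\<in>\<A>. \<exists>(V, g)\<in>\<B>. smooth_in_charts U f V g F x)"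

lemma smooth_atI:
  "(U, f) \<in> \<A> \<Longrightarrow> (V, g) \<in> \<B> \<Longrightarrow> smooth_in_charts U f V g F x \<Longrightarrow> smooth_at \<A> \<B> F x"
  unfolding smooth_at_def by blast

lemma smooth_atE:
  assumes "smooth_at \<A> \<B> F x"
  obtains U f V g where "(U, f) \<in> \<A>" "(V, g) \<in> \<B>" "smooth_in_charts U f V g F x"
  using assms unfolding smooth_at_def by blast

lemma smooth_in_charts_mem:
  assumes "inj_on f U" "smooth_in_charts U f V g F x"
  shows "x \<in> U" "F x \<in> V"
  using assms unfolding smooth_in_charts_def by (auto simp: inv_into_f_f)

lemma smooth_at_mem:
  assumes "findim_atlas \<A>" "smooth_at \<A> \<B> F x"
  shows "x \<in> mcarrier \<A>" "F x \<in> mcarrier \<B>"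
proof -
  obtain U f V g where *: "(U, f) \<in> \<A>" "(V, g) \<in> \<B>" "smooth_in_charts U f V g F x"
    using assms(2) by (rule smooth_atE)
  show "x \<in> mcarrier \<A>" "F x \<in> mcarrier \<B>"
    using * smooth_in_charts_mem[OF atlasD(1)[OF assms(1) *(1)] *(3)] by (auto intro: mcarrierI)
qed

text \<open>
  Independence of the choice of charts, by composing with the identity on either side.
\<close>

lemma smooth_at_charts:
  assumes A: "findim_atlas \<A>" and B: "findim_atlas \<B>" and F: "smooth_at \<A> \<B> F x"
    and U: "(U, f) \<in> \<A>" "x \<in> U" and V: "(V, g) \<in> \<B>" "F x \<in> V"
  shows "smooth_in_charts U f V g F x"
proof -
  obtain U' f' V' g' where *: "(U', f') \<in> \<A>" "(V', g') \<in> \<B>" "smooth_in_charts U' f' V' g' F x"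
    using F by (rule smooth_atE)
  note mem = smooth_in_charts_mem[OF atlasD(1)[OF A *(1)] *(3)]
  note fd = A[unfolded findim_atlas_def, THEN conjunct2] B[unfolded findim_atlas_def, THEN conjunct2]
  have "smooth_in_charts U f V' g' F x"
    by (rule smooth_in_charts_compose[OF fd(1) atlasD(1)[OF A U(1)] atlasD(1)[OF A *(1)]
        smooth_in_charts_transition[OF A U(1) *(1) U(2) mem(1)] *(3)])
  from smooth_in_charts_compose[OF fd(2) atlasD(1)[OF A U(1)] atlasD(1)[OF B *(2)] this
        smooth_in_charts_transition[OF B *(2) V(1) mem(2) V(2)]]
  show ?thesis .
qed

lemma smooth_map_continuous:
  assumes "smooth_map \<A> \<B> F"
  shows "continuous_map (mtopology \<A>) (mtopology \<B>) F"
proof -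
  have "continuous_map (subtopology (mtopology \<A>) (mcarrier \<A>)) (mtopology \<B>) F"
    using assms unfolding smooth_map_def smooth_map_open_def by blast
  thus ?thesis using subtopology_topspace[of "mtopology \<A>"] by (simp add: topspace_mtopology)
qed

lemma smooth_map_carrier: "smooth_map \<A> \<B> F \<Longrightarrow> x \<in> mcarrier \<A> \<Longrightarrow> F x \<in> mcarrier \<B>"
  using continuous_map_image_subset_topspace[OF smooth_map_continuous, of \<A> \<B> F]
  by (auto simp: topspace_mtopology)

text \<open>
  In one direction, continuity of \<open>F\<close> makes the domain of its coordinate representation open.  In the
  other, continuity of \<open>F\<close> follows from that of its local representations, and smoothness in arbitrary
  charts from independence of charts, since smoothness is local.
\<close>

lemma smooth_map_iff_smooth_at:
  assumes A: "findim_atlas \<A>" and B: "findim_atlas \<B>"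
  shows "smooth_map \<A> \<B> F \<longleftrightarrow> (\<forall>x\<in>mcarrier \<A>. smooth_at \<A> \<B> F x)"
proof (intro iffI ballI)
  fix x assume F: "smooth_map \<A> \<B> F" and x: "x \<in> mcarrier \<A>"
  obtain U f where U: "(U, f) \<in> \<A>" "x \<in> U" using x by (rule mcarrierE)
  obtain V g where V: "(V, g) \<in> \<B>" "F x \<in> V"
    using smooth_map_carrier[OF F x] by (rule mcarrierE)
  have sm: "smooth_on (f ` (U \<inter> mcarrier \<A> \<inter> F -` V)) (\<lambda>y. g (F (inv_into U f y)))"
    using F U(1) V(1) unfolding smooth_map_def smooth_map_open_def o_def by blast
  note cont = smooth_map_continuous[OF F]
  have "openin (mtopology \<B>) V"
    using openin_chart_preimage[OF V(1), of UNIV] by simp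
  hence "openin (mtopology \<A>) {x \<in> mcarrier \<A>. F x \<in> V}"
    using openin_continuous_map_preimage[OF cont] by (simp add: topspace_mtopology)
  hence "open (f ` ({x \<in> mcarrier \<A>. F x \<in> V} \<inter> U))"
    by (rule open_chart_image[OF A U(1)])
  moreover have "{x \<in> mcarrier \<A>. F x \<in> V} \<inter> U = U \<inter> mcarrier \<A> \<inter> F -` V" by auto
  ultimately have op: "open (f ` (U \<inter> mcarrier \<A> \<inter> F -` V))" by simp
  have "smooth_in_charts U f V g F x"
    unfolding smooth_in_charts_def
  proof (intro conjI exI[of _ "f ` (U \<inter> mcarrier \<A> \<inter> F -` V)"] op sm U(2))
    show "\<forall>y\<in>f ` (U \<inter> mcarrier \<A> \<inter> F -` V). F (inv_into U f y) \<in> V"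
      using atlasD(1)[OF A U(1)] by auto
  qed (use U V x in auto)
  thus "smooth_at \<A> \<B> F x" using U(1) V(1) by (intro smooth_atI)
next
  assume F: "\<forall>x\<in>mcarrier \<A>. smooth_at \<A> \<B> F x"
  show "smooth_map \<A> \<B> F"
    unfolding smooth_map_def smooth_map_open_def
  proof
    have "openin (mtopology \<A>) {x \<in> mcarrier \<A>. F x \<in> T}" if T: "openin (mtopology \<B>) T" for T
    proof (subst openin_subopen, intro ballI)
      fix x assume "x \<in> {x \<in> mcarrier \<A>. F x \<in> T}"
      hence x: "x \<in> mcarrier \<A>" "F x \<in> T" by auto
      then obtain U f V g where *: "(U, f) \<in> \<A>" "(V, g) \<in> \<B>" "smooth_in_charts U f V g F x"
        using F by (meson smooth_atE)
      let ?i = "inv_into U f"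
      obtain M where M: "x \<in> U" "open M" "f x \<in> M" "M \<subseteq> f ` U" "\<And>y. y \<in> M \<Longrightarrow> F (?i y) \<in> V"
          "smooth_on M (\<lambda>y. g (F (?i y)))"
        using *(3) unfolding smooth_in_charts_def by blast
      note inj = atlasD(1)[OF A *(1)] atlasD(1)[OF B *(2)]
      let ?N = "M \<inter> (\<lambda>y. g (F (?i y))) -` (g ` (T \<inter> V))"
      have N: "open ?N"
        by (rule continuous_open_preimage[OF smooth_on_continuous[OF M(6)] M(2)
              open_chart_image[OF B *(2) T]])
      have "openin (mtopology \<A>) (U \<inter> f -` ?N)"
        by (rule openin_chart_preimage[OF *(1) N])
      moreover have "x \<in> U \<inter> f -` ?N"
        using M(1,3) M(5)[OF M(3)] x inj(1) by auto
      moreover have "U \<inter> f -` ?N \<subseteq> {x \<in> mcarrier \<A>. F x \<in> T}"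
      proof
        fix z assume z: "z \<in> U \<inter> f -` ?N"
        have "?i (f z) = z" using z inj by simp
        hence "F z \<in> V" "g (F z) \<in> g ` (T \<inter> V)" using z M(5)[of "f z"] by auto
        hence "F z \<in> T" using inj(2) by (auto simp: inj_on_def)
        thus "z \<in> {x \<in> mcarrier \<A>. F x \<in> T}" using z *(1) by (auto intro: mcarrierI)
      qed
      ultimately show "\<exists>S. openin (mtopology \<A>) S \<and> x \<in> S \<and> S \<subseteq> {x \<in> mcarrier \<A>. F x \<in> T}"
        by blast
    qed
    moreover have "F x \<in> mcarrier \<B>" if "x \<in> mcarrier \<A>" for x
      using smooth_at_mem(2)[OF A] F that by blast
    ultimately have "continuous_map (mtopology \<A>) (mtopology \<B>) F"
      unfolding continuous_map_def by (auto simp: topspace_mtopology)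
    thus "continuous_map (subtopology (mtopology \<A>) (mcarrier \<A>)) (mtopology \<B>) F"
      by (rule continuous_map_from_subtopology)
  next
    have "smooth_on (f ` (U \<inter> mcarrier \<A> \<inter> F -` V)) (\<lambda>y. g (F (inv_into U f y)))"
      if c: "(U, f) \<in> \<A>" and d: "(V, g) \<in> \<B>" for U f V g
    proof (rule smooth_on_local)
      fix y assume "y \<in> f ` (U \<inter> mcarrier \<A> \<inter> F -` V)"
      then obtain x where x: "x \<in> U" "x \<in> mcarrier \<A>" "F x \<in> V" "y = f x" by blast
      have "smooth_in_charts U f V g F x"
        using smooth_at_charts[where F = F, OF A B _ c x(1) d x(3)] F x(2) by blast
      thus "\<exists>N. open N \<and> y \<in> N \<and> smooth_on N (\<lambda>y. g (F (inv_into U f y)))"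
        unfolding smooth_in_charts_def x(4) by blast
    qed
    thus "\<forall>(U, f)\<in>\<A>. \<forall>(V, g)\<in>\<B>.
        smooth_on (f ` (U \<inter> mcarrier \<A> \<inter> F -` V)) (g \<circ> F \<circ> inv_into U f)"
      unfolding o_def by blast
  qed
qed

lemma smooth_map_at:
  assumes "findim_atlas \<A>" "findim_atlas \<B>" "smooth_map \<A> \<B> F" "x \<in> mcarrier \<A>"
  shows "smooth_at \<A> \<B> F x"
  using smooth_map_iff_smooth_at[OF assms(1,2), of F] assms(3,4) by simp

lemma smooth_map_cong:
  assumes A: "findim_atlas \<A>" and B: "findim_atlas \<B>" and F: "smooth_map \<A> \<B> F"
    and eq: "\<And>x. x \<in> mcarrier \<A> \<Longrightarrow> F x = G x"
  shows "smooth_map \<A> \<B> G"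
  unfolding smooth_map_iff_smooth_at[OF A B]
proof
  fix x assume x: "x \<in> mcarrier \<A>"
  obtain U f V g where *: "(U, f) \<in> \<A>" "(V, g) \<in> \<B>" "smooth_in_charts U f V g F x"
    using smooth_map_at[OF A B F x] by (rule smooth_atE)
  let ?i = "inv_into U f"
  obtain N where N: "x \<in> U" "open N" "f x \<in> N" "N \<subseteq> f ` U" "\<And>y. y \<in> N \<Longrightarrow> F (?i y) \<in> V"
      "smooth_on N (\<lambda>y. g (F (?i y)))"
    using *(3) unfolding smooth_in_charts_def by blast
  have FG: "F (?i y) = G (?i y)" if "y \<in> N" for y
    using N(4) that inv_into_into[of y f U] by (intro eq mcarrierI[OF *(1)]) blast
  have "smooth_on N (\<lambda>y. g (G (?i y)))"
    using N(6) smooth_on_cong[OF N(2), of "\<lambda>y. g (F (?i y))" "\<lambda>y. g (G (?i y))"] FG by simp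
  hence "smooth_in_charts U f V g G x"
    unfolding smooth_in_charts_def using N FG by (intro conjI exI[of _ N]) auto
  thus "smooth_at \<A> \<B> G x" by (rule smooth_atI[OF *(1,2)])
qed

lemma smooth_at_compose:
  assumes "findim_atlas \<A>" "findim_atlas \<B>" "findim_atlas \<C>"
    and F: "smooth_at \<A> \<B> F x" and G: "smooth_at \<B> \<C> G (F x)"
  shows "smooth_at \<A> \<C> (\<lambda>x. G (F x)) x"
proof -
  obtain V g W h where *: "(V, g) \<in> \<B>" "(W, h) \<in> \<C>" "smooth_in_charts V g W h G (F x)"
    using G by (rule smooth_atE)
  obtain U f where U: "(U, f) \<in> \<A>" "x \<in> U"
    using smooth_at_mem(1)[OF assms(1) F] by (rule mcarrierE)
  have "smooth_in_charts U f V g F x"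
    using smooth_at_charts[OF assms(1,2) F U *(1)] *(3) by (simp add: smooth_in_charts_def)
  with * have "smooth_in_charts U f W h (\<lambda>x. G (F x)) x"
    using atlasD(1) assms(1,2) U(1) unfolding findim_atlas_def
    by (intro smooth_in_charts_compose[of f U g V F x W h G]) (auto simp: is_atlas_def)
  thus ?thesis using U(1) *(2) by (intro smooth_atI)
qed

lemma smooth_map_compose:
  assumes "findim_atlas \<A>" "findim_atlas \<B>" "findim_atlas \<C>"
    and "smooth_map \<A> \<B> F" "smooth_map \<B> \<C> G"
  shows "smooth_map \<A> \<C> (\<lambda>x. G (F x))"
  unfolding smooth_map_iff_smooth_at[OF assms(1,3)]
proof
  fix x assume x: "x \<in> mcarrier \<A>"
  show "smooth_at \<A> \<C> (\<lambda>x. G (F x)) x"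
  proof (rule smooth_at_compose[where F = F and G = G, OF assms(1-3)])
    show "smooth_at \<A> \<B> F x"
      using assms(4) x smooth_map_iff_smooth_at[OF assms(1,2), of F] by simp
    show "smooth_at \<B> \<C> G (F x)"
      using assms(5) smooth_map_carrier[OF assms(4) x] smooth_map_iff_smooth_at[OF assms(2,3), of G]
      by simp
  qed
qed

section \<open>Vector spaces and products as manifolds\<close>

lemma findim_atlas_vec:
  assumes "finite_dimensional TYPE('e::real_normed_vector)"
  shows "findim_atlas (vec_atlas :: ('e, 'e) atlas)"
proof -
  have "smooth_on UNIV (id :: 'e \<Rightarrow> 'e)"
    using smooth_on_bounded_linear[OF open_UNIV bounded_linear_ident] unfolding id_def .
  thus ?thesis
    using assms by (simp add: findim_atlas_def vec_atlas_def is_atlas_def)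
qed

lemma mcarrier_vec: "mcarrier vec_atlas = UNIV"
  by (simp add: mcarrier_def vec_atlas_def)

text \<open>
  This lets binary operations on vector spaces be treated as maps from a single vector space.
\<close>

lemma prod_atlas_vec: "prod_atlas vec_atlas vec_atlas = vec_atlas"
  unfolding prod_atlas_def vec_atlas_def using map_prod.id by (simp add: UNIV_Times_UNIV)

lemma smooth_map_vec:
  fixes F :: "'e::real_normed_vector \<Rightarrow> 'f::real_normed_vector"
  assumes fd: "finite_dimensional TYPE('e)" "finite_dimensional TYPE('f)"
    and F: "smooth_on UNIV F"
  shows "smooth_map vec_atlas vec_atlas F"
  unfolding smooth_map_iff_smooth_at[OF findim_atlas_vec[OF fd(1)] findim_atlas_vec[OF fd(2)]]
proof
  fix x :: 'e
  have "smooth_in_charts UNIV id UNIV id F x"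
    unfolding smooth_in_charts_def
    by (intro conjI exI[of _ UNIV]) (use F in \<open>simp_all add: inv_id\<close>)
  thus "smooth_at vec_atlas vec_atlas F x"
    by (auto intro: smooth_atI simp: vec_atlas_def)
qed

lemma mcarrier_prod: "mcarrier (prod_atlas \<A> \<B>) = mcarrier \<A> \<times> mcarrier \<B>"
  unfolding mcarrier_def prod_atlas_def by blast

lemma prod_atlasI: "(U, f) \<in> \<A> \<Longrightarrow> (V, g) \<in> \<B> \<Longrightarrow> (U \<times> V, map_prod f g) \<in> prod_atlas \<A> \<B>"
  unfolding prod_atlas_def by blast

lemma inv_into_map_prod:
  assumes "inj_on f U" "inj_on g V" "y \<in> f ` U" "z \<in> g ` V"
  shows "inv_into (U \<times> V) (map_prod f g) (y, z) = (inv_into U f y, inv_into V g z)"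
  using assms by (intro inv_into_f_eq map_prod_inj_on) (auto simp: f_inv_into_f inv_into_into)

lemma image_map_prod: "map_prod f g ` (U \<times> V) = f ` U \<times> g ` V"
  by auto

lemma findim_atlas_prod:
  fixes \<A> :: "('a, 'e::real_normed_vector) atlas" and \<B> :: "('b, 'f::real_normed_vector) atlas"
  assumes A: "findim_atlas \<A>" and B: "findim_atlas \<B>"
  shows "findim_atlas (prod_atlas \<A> \<B>)"
proof -
  have fdA: "finite_dimensional TYPE('e)" and fdB: "finite_dimensional TYPE('f)"
    using assms by (auto simp: findim_atlas_def)
  have 1: "inj_on c P \<and> open (c ` P)" if P: "(P, c) \<in> prod_atlas \<A> \<B>" for P c
  proof -
    obtain U f V g where *: "P = U \<times> V" "c = map_prod f g" "(U, f) \<in> \<A>" "(V, g) \<in> \<B>"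
      using P unfolding prod_atlas_def by blast
    show ?thesis
      unfolding * image_map_prod using atlasD(1,2)[OF A *(3)] atlasD(1,2)[OF B *(4)]
      by (simp add: map_prod_inj_on open_Times)
  qed
  have 2: "open (c ` (P \<inter> Q)) \<and> smooth_on (c ` (P \<inter> Q)) (d \<circ> inv_into P c)"
    if P: "(P, c) \<in> prod_atlas \<A> \<B>" and Q: "(Q, d) \<in> prod_atlas \<A> \<B>" for P c Q d
  proof -
    obtain U f V g where *: "P = U \<times> V" "c = map_prod f g" "(U, f) \<in> \<A>" "(V, g) \<in> \<B>"
      using P unfolding prod_atlas_def by blast
    obtain U' f' V' g' where **: "Q = U' \<times> V'" "d = map_prod f' g'" "(U', f') \<in> \<A>" "(V', g') \<in> \<B>"
      using Q unfolding prod_atlas_def by blast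
    let ?S = "f ` (U \<inter> U')" and ?T = "g ` (V \<inter> V')"
    have im: "c ` (P \<inter> Q) = ?S \<times> ?T" unfolding * ** Times_Int_Times image_map_prod ..
    note S = atlasD(3,4)[OF A *(3) **(3)] and T = atlasD(3,4)[OF B *(4) **(4)]
    have op: "open (?S \<times> ?T)" using S(1) T(1) by (rule open_Times)
    have "smooth_on (?S \<times> ?T) (\<lambda>z. (f' (inv_into U f (fst z)), g' (inv_into V g (snd z))))"
      by (intro smooth_on_Pair op
            smooth_on_compose[OF fdA op S(1) _ smooth_on_bounded_linear[OF op bounded_linear_fst] S(2)]
            smooth_on_compose[OF fdB op T(1) _ smooth_on_bounded_linear[OF op bounded_linear_snd] T(2)])
         auto
    moreover have "(d \<circ> inv_into P c) z = (f' (inv_into U f (fst z)), g' (inv_into V g (snd z)))"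
      if "z \<in> ?S \<times> ?T" for z
      using that inv_into_map_prod[OF atlasD(1)[OF A *(3)] atlasD(1)[OF B *(4)], of "fst z" "snd z"]
      unfolding * ** by (auto simp del: inv_into_f_f)
    ultimately show ?thesis
      unfolding im using op smooth_on_cong[OF op, of "d \<circ> inv_into P c"] by simp
  qed
  show ?thesis
    using 1 2 finite_dimensional_prod[OF fdA fdB]
    unfolding findim_atlas_def is_atlas_def by blast
qed

lemma smooth_map_Pair:
  assumes "findim_atlas \<A>" "findim_atlas \<B>" "findim_atlas \<C>"
    and F: "smooth_map \<A> \<B> F" and G: "smooth_map \<A> \<C> G"
  shows "smooth_map \<A> (prod_atlas \<B> \<C>) (\<lambda>x. (F x, G x))"
  unfolding smooth_map_iff_smooth_at[OF assms(1) findim_atlas_prod[OF assms(2,3)]]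
proof
  fix x assume x: "x \<in> mcarrier \<A>"
  obtain U f where U: "(U, f) \<in> \<A>" "x \<in> U" using x by (rule mcarrierE)
  obtain V g where V: "(V, g) \<in> \<B>" "F x \<in> V"
    using smooth_map_carrier[OF F x] by (rule mcarrierE)
  obtain W h where W: "(W, h) \<in> \<C>" "G x \<in> W"
    using smooth_map_carrier[OF G x] by (rule mcarrierE)
  let ?i = "inv_into U f"
  have "smooth_in_charts U f V g F x"
    using smooth_at_charts[where F = F, OF assms(1,2) _ U V] F x
      smooth_map_iff_smooth_at[OF assms(1,2), of F] by simp
  then obtain M where M: "open M" "f x \<in> M" "M \<subseteq> f ` U" "\<And>y. y \<in> M \<Longrightarrow> F (?i y) \<in> V"
      "smooth_on M (\<lambda>y. g (F (?i y)))"
    unfolding smooth_in_charts_def by blast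
  have "smooth_in_charts U f W h G x"
    using smooth_at_charts[where F = G, OF assms(1,3) _ U W] G x
      smooth_map_iff_smooth_at[OF assms(1,3), of G] by simp
  then obtain N where N: "open N" "f x \<in> N" "N \<subseteq> f ` U" "\<And>y. y \<in> N \<Longrightarrow> G (?i y) \<in> W"
      "smooth_on N (\<lambda>y. h (G (?i y)))"
    unfolding smooth_in_charts_def by blast
  have op: "open (M \<inter> N)" using M(1) N(1) by blast
  have "smooth_in_charts U f (V \<times> W) (map_prod g h) (\<lambda>x. (F x, G x)) x"
    unfolding smooth_in_charts_def map_prod_simp
  proof (intro conjI exI[of _ "M \<inter> N"] op U(2))
    show "smooth_on (M \<inter> N) (\<lambda>y. (g (F (?i y)), h (G (?i y))))"
      using smooth_on_Pair[OF op smooth_on_subset[OF M(5)] smooth_on_subset[OF N(5)]] by simp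
  qed (use M N in auto)
  thus "smooth_at \<A> (prod_atlas \<B> \<C>) (\<lambda>x. (F x, G x)) x"
    by (rule smooth_atI[OF U(1) prod_atlasI[OF V(1) W(1)]])
qed

lemma smooth_map_fst:
  assumes A: "findim_atlas \<A>" and B: "findim_atlas \<B>"
  shows "smooth_map (prod_atlas \<A> \<B>) \<A> fst"
  unfolding smooth_map_iff_smooth_at[OF findim_atlas_prod[OF A B] A]
proof
  fix x assume "x \<in> mcarrier (prod_atlas \<A> \<B>)"
  then obtain U f V g where *: "(U, f) \<in> \<A>" "(V, g) \<in> \<B>" "x \<in> U \<times> V"
    unfolding mcarrier_def prod_atlas_def by blast
  note inj = atlasD(1)[OF A *(1)] atlasD(1)[OF B *(2)]
  let ?N = "f ` U \<times> g ` V"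
  have op: "open ?N" using atlasD(2)[OF A *(1)] atlasD(2)[OF B *(2)] by (rule open_Times)
  have eq: "inv_into (U \<times> V) (map_prod f g) y = (inv_into U f (fst y), inv_into V g (snd y))"
    if "y \<in> ?N" for y
    using inv_into_map_prod[OF inj, of "fst y" "snd y"] that by auto
  have "smooth_in_charts (U \<times> V) (map_prod f g) U f fst x"
    unfolding smooth_in_charts_def
  proof (intro conjI exI[of _ ?N] op *(3))
    have "smooth_on ?N fst" by (rule smooth_on_bounded_linear[OF op bounded_linear_fst])
    moreover have "f (fst (inv_into (U \<times> V) (map_prod f g) y)) = fst y" if "y \<in> ?N" for y
      using that eq[OF that] by (auto simp: f_inv_into_f)
    ultimately show "smooth_on ?N (\<lambda>y. f (fst (inv_into (U \<times> V) (map_prod f g) y)))"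
      using smooth_on_cong[OF op, of "\<lambda>y. f (fst (inv_into (U \<times> V) (map_prod f g) y))" fst] by blast
    show "\<forall>y\<in>?N. fst (inv_into (U \<times> V) (map_prod f g) y) \<in> U"
      using eq by (auto simp: inv_into_into)
  qed (use * in auto)
  thus "smooth_at (prod_atlas \<A> \<B>) \<A> fst x"
    by (rule smooth_atI[OF prod_atlasI[OF *(1,2)] *(1)])
qed

lemma smooth_map_snd:
  assumes A: "findim_atlas \<A>" and B: "findim_atlas \<B>"
  shows "smooth_map (prod_atlas \<A> \<B>) \<B> snd"
  unfolding smooth_map_iff_smooth_at[OF findim_atlas_prod[OF A B] B]
proof
  fix x assume "x \<in> mcarrier (prod_atlas \<A> \<B>)"
  then obtain U f V g where *: "(U, f) \<in> \<A>" "(V, g) \<in> \<B>" "x \<in> U \<times> V"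
    unfolding mcarrier_def prod_atlas_def by blast
  note inj = atlasD(1)[OF A *(1)] atlasD(1)[OF B *(2)]
  let ?N = "f ` U \<times> g ` V"
  have op: "open ?N" using atlasD(2)[OF A *(1)] atlasD(2)[OF B *(2)] by (rule open_Times)
  have eq: "inv_into (U \<times> V) (map_prod f g) y = (inv_into U f (fst y), inv_into V g (snd y))"
    if "y \<in> ?N" for y
    using inv_into_map_prod[OF inj, of "fst y" "snd y"] that by auto
  have "smooth_in_charts (U \<times> V) (map_prod f g) V g snd x"
    unfolding smooth_in_charts_def
  proof (intro conjI exI[of _ ?N] op *(3))
    have "smooth_on ?N snd" by (rule smooth_on_bounded_linear[OF op bounded_linear_snd])
    moreover have "g (snd (inv_into (U \<times> V) (map_prod f g) y)) = snd y" if "y \<in> ?N" for y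
      using that eq[OF that] by (auto simp: f_inv_into_f)
    ultimately show "smooth_on ?N (\<lambda>y. g (snd (inv_into (U \<times> V) (map_prod f g) y)))"
      using smooth_on_cong[OF op, of "\<lambda>y. g (snd (inv_into (U \<times> V) (map_prod f g) y))" snd] by blast
    show "\<forall>y\<in>?N. snd (inv_into (U \<times> V) (map_prod f g) y) \<in> V"
      using eq by (auto simp: inv_into_into)
  qed (use * in auto)
  thus "smooth_at (prod_atlas \<A> \<B>) \<B> snd x"
    by (rule smooth_atI[OF prod_atlasI[OF *(1,2)] *(2)])
qed

lemma smooth_map_const:
  assumes A: "findim_atlas \<A>" and B: "findim_atlas \<B>" and c: "c \<in> mcarrier \<B>"
  shows "smooth_map \<A> \<B> (\<lambda>_. c)"
  unfolding smooth_map_iff_smooth_at[OF A B]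
proof
  fix x assume "x \<in> mcarrier \<A>"
  then obtain U f where U: "(U, f) \<in> \<A>" "x \<in> U" by (rule mcarrierE)
  obtain V g where V: "(V, g) \<in> \<B>" "c \<in> V" using c by (rule mcarrierE)
  have "smooth_in_charts U f V g (\<lambda>_. c) x"
    unfolding smooth_in_charts_def
    using U V atlasD(2)[OF A U(1)]
    by (intro conjI exI[of _ "f ` U"]) (auto simp: smooth_on_def Ck_on_const)
  thus "smooth_at \<A> \<B> (\<lambda>_. c) x" using U(1) V(1) by (intro smooth_atI)
qed

lemma smooth_map_bilinear:
  fixes F :: "'a \<Rightarrow> 'e::real_normed_vector" and G :: "'a \<Rightarrow> 'f::real_normed_vector"
    and pr :: "'e \<Rightarrow> 'f \<Rightarrow> 'd::real_normed_vector"
  assumes A: "findim_atlas \<A>" and pr: "bounded_bilinear pr"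
    and fd: "finite_dimensional TYPE('e)" "finite_dimensional TYPE('f)" "finite_dimensional TYPE('d)"
    and F: "smooth_map \<A> vec_atlas F" and G: "smooth_map \<A> vec_atlas G"
  shows "smooth_map \<A> vec_atlas (\<lambda>x. pr (F x) (G x))"
proof -
  have "smooth_on UNIV (\<lambda>z. pr (fst z) (snd z))"
    by (intro smooth_on_bounded_bilinear[OF pr] smooth_on_bounded_linear open_UNIV
        bounded_linear_fst bounded_linear_snd)
  note P = smooth_map_vec[OF finite_dimensional_prod[OF fd(1,2)] fd(3) this]
  have "smooth_map \<A> vec_atlas (\<lambda>x. (F x, G x))"
    using smooth_map_Pair[OF A findim_atlas_vec[OF fd(1)] findim_atlas_vec[OF fd(2)] F G]
    by (simp add: prod_atlas_vec)
  from smooth_map_compose[OF A findim_atlas_vec[OF finite_dimensional_prod[OF fd(1,2)]]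
      findim_atlas_vec[OF fd(3)] this P]
  show ?thesis by simp
qed

lemma smooth_map_add:
  fixes F G :: "'a \<Rightarrow> 'e::real_normed_vector"
  assumes A: "findim_atlas \<A>" and fd: "finite_dimensional TYPE('e)"
    and F: "smooth_map \<A> vec_atlas F" and G: "smooth_map \<A> vec_atlas G"
  shows "smooth_map \<A> vec_atlas (\<lambda>x. F x + G x)"
proof -
  have "bounded_linear (\<lambda>z :: 'e \<times> 'e. fst z + snd z)"
    by (intro bounded_linear_add bounded_linear_fst bounded_linear_snd)
  from smooth_map_vec[OF finite_dimensional_prod[OF fd fd] fd smooth_on_bounded_linear[OF open_UNIV this]]
  have P: "smooth_map vec_atlas vec_atlas (\<lambda>z :: 'e \<times> 'e. fst z + snd z)" .
  have "smooth_map \<A> vec_atlas (\<lambda>x. (F x, G x))"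
    using smooth_map_Pair[OF A findim_atlas_vec[OF fd] findim_atlas_vec[OF fd] F G]
    by (simp add: prod_atlas_vec)
  from smooth_map_compose[OF A findim_atlas_vec[OF finite_dimensional_prod[OF fd fd]]
      findim_atlas_vec[OF fd] this P]
  show ?thesis by simp
qed

lemma smooth_map_sum:
  fixes F :: "'i \<Rightarrow> 'a \<Rightarrow> 'e::real_normed_vector"
  assumes A: "findim_atlas \<A>" and fd: "finite_dimensional TYPE('e)"
    and F: "\<And>i. i \<in> I \<Longrightarrow> smooth_map \<A> vec_atlas (F i)"
  shows "smooth_map \<A> vec_atlas (\<lambda>x. \<Sum>i\<in>I. F i x)"
proof -
  have zero: "smooth_map \<A> vec_atlas (\<lambda>x. 0 :: 'e)"
    by (rule smooth_map_const[OF A findim_atlas_vec[OF fd]]) (simp add: mcarrier_vec)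
  show ?thesis
    using F
  proof (induction I rule: infinite_finite_induct)
    case (insert i I)
    have "smooth_map \<A> vec_atlas (F i)" "smooth_map \<A> vec_atlas (\<lambda>x. \<Sum>i\<in>I. F i x)"
      using insert.IH insert.prems by blast+
    from smooth_map_add[OF A fd this] show ?case
      unfolding sum.insert[OF insert.hyps(1,2)] .
  next
    case empty
    show ?case unfolding sum.empty by (rule zero)
  next
    case (infinite I)
    show ?case unfolding sum.infinite[OF infinite.hyps] by (rule zero)
  qed
qed

lemma smooth_map_fst_of:
  assumes "findim_atlas \<A>" "findim_atlas \<B>" "findim_atlas \<C>" "smooth_map \<A> (prod_atlas \<B> \<C>) F"
  shows "smooth_map \<A> \<B> (\<lambda>x. fst (F x))"
  by (rule smooth_map_compose[where F = F and G = fst, OF assms(1) findim_atlas_prod[OF assms(2,3)]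
        assms(2,4) smooth_map_fst[OF assms(2,3)]])

lemma smooth_map_snd_of:
  assumes "findim_atlas \<A>" "findim_atlas \<B>" "findim_atlas \<C>" "smooth_map \<A> (prod_atlas \<B> \<C>) F"
  shows "smooth_map \<A> \<C> (\<lambda>x. snd (F x))"
  by (rule smooth_map_compose[where F = F and G = snd, OF assms(1) findim_atlas_prod[OF assms(2,3)]
        assms(3,4) smooth_map_snd[OF assms(2,3)]])

lemma smooth_map_compose2:
  assumes "findim_atlas \<A>" "findim_atlas \<B>" "findim_atlas \<C>" "findim_atlas \<D>"
    and "smooth_map (prod_atlas \<B> \<C>) \<D> (\<lambda>(y, z). a y z)"
    and "smooth_map \<A> \<B> F" "smooth_map \<A> \<C> G"
  shows "smooth_map \<A> \<D> (\<lambda>x. a (F x) (G x))"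
  using smooth_map_compose[where F = "\<lambda>x. (F x, G x)" and G = "\<lambda>(y, z). a y z",
      OF assms(1) findim_atlas_prod[OF assms(2,3)] assms(4) smooth_map_Pair[OF assms(1-3,6,7)] assms(5)]
  by simp

section \<open>Velocities of curves\<close>

lemma smooth_at_ident:
  assumes "findim_atlas \<A>" "x \<in> mcarrier \<A>"
  shows "smooth_at \<A> \<A> (\<lambda>x. x) x"
proof -
  obtain U f where U: "(U, f) \<in> \<A>" "x \<in> U" using assms(2) by (rule mcarrierE)
  show ?thesis
    by (rule smooth_atI[OF U(1) U(1) smooth_in_charts_transition[OF assms(1) U(1) U(1) U(2) U(2)]])
qed

lemma smooth_map_ident: "findim_atlas \<A> \<Longrightarrow> smooth_map \<A> \<A> (\<lambda>x. x)"
  using smooth_at_ident[of \<A>] smooth_map_iff_smooth_at[of \<A> \<A> "\<lambda>x. x"] by simp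

lemma vec_chart: "(UNIV, id) \<in> vec_atlas"
  by (simp add: vec_atlas_def)

lemma smooth_curve_chart:
  fixes c :: "real \<Rightarrow> 'a" and \<A> :: "('a, 'e::real_normed_vector) atlas"
  assumes A: "findim_atlas \<A>" and c: "smooth_at vec_atlas \<A> c 0" and U: "(U, f) \<in> \<A>" "c 0 \<in> U"
  obtains N where "open N" "0 \<in> N" "\<And>t. t \<in> N \<Longrightarrow> c t \<in> U" "smooth_on N (\<lambda>t. f (c t))"
proof -
  have "smooth_in_charts UNIV id U f c 0"
    by (rule smooth_at_charts[where F = c, OF findim_atlas_vec[OF finite_dimensional_real] A c
          vec_chart UNIV_I U])
  thus ?thesis
    unfolding smooth_in_charts_def using that by auto
qed

lemma smooth_curve_velocity:
  fixes c :: "real \<Rightarrow> 'a" and \<A> :: "('a, 'e::real_normed_vector) atlas"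
  assumes A: "findim_atlas \<A>" and c: "smooth_at vec_atlas \<A> c 0" and U: "(U, f) \<in> \<A>" "c 0 \<in> U"
  obtains v where "((\<lambda>t. f (c t)) has_vector_derivative v) (at 0)"
proof -
  obtain N where N: "open N" "0 \<in> N" "smooth_on N (\<lambda>t. f (c t))"
    using smooth_curve_chart[OF assms] by metis
  let ?D = "frechet_derivative (\<lambda>t. f (c t)) (at 0)"
  have D: "((\<lambda>t. f (c t)) has_derivative ?D) (at 0)"
    by (rule smooth_on_frechet_derivative(1)[OF N(3,2)])
  have "?D t = t *\<^sub>R ?D 1" for t
    using linear_cmul[OF has_derivative_linear[OF D], of t 1] by simp
  hence "?D = (\<lambda>t. t *\<^sub>R ?D 1)" by (rule ext)
  with D have "((\<lambda>t. f (c t)) has_derivative (\<lambda>t. t *\<^sub>R ?D 1)) (at 0)" by simp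
  thus ?thesis using that unfolding has_vector_derivative_def by blast
qed

lemma smooth_at_chart_derivative:
  assumes A: "findim_atlas \<A>" and B: "findim_atlas \<B>" and F: "smooth_at \<A> \<B> F x"
    and U: "(U, f) \<in> \<A>" "x \<in> U" and V: "(V, g) \<in> \<B>" "F x \<in> V"
  obtains K where "((\<lambda>y. g (F (inv_into U f y))) has_derivative K) (at (f x))"
proof -
  have "smooth_in_charts U f V g F x"
    by (rule smooth_at_charts[where F = F, OF A B F U V])
  then obtain N where N: "f x \<in> N" "smooth_on N (\<lambda>y. g (F (inv_into U f y)))"
    unfolding smooth_in_charts_def by blast
  show ?thesis by (rule that[OF smooth_on_frechet_derivative(1)[OF N(2,1)]])
qed

lemma has_vector_derivative_compose:
  assumes "(c has_vector_derivative v) (at t)" "(k has_derivative K) (at (c t))"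
  shows "((\<lambda>t. k (c t)) has_vector_derivative K v) (at t)"
  using vector_derivative_diff_chain_within[OF assms(1) has_derivative_at_withinI[OF assms(2)]]
  by (simp add: o_def)

lemma chart_velocity_image:
  fixes c :: "real \<Rightarrow> 'a" and \<A> :: "('a, 'e::real_normed_vector) atlas"
  assumes A: "findim_atlas \<A>" and c: "smooth_at vec_atlas \<A> c 0" and U: "(U, f) \<in> \<A>" "c 0 \<in> U"
    and v: "((\<lambda>t. f (c t)) has_vector_derivative v) (at 0)"
    and K: "((\<lambda>y. g (F (inv_into U f y))) has_derivative K) (at (f (c 0)))"
  shows "((\<lambda>t. g (F (c t))) has_vector_derivative K v) (at 0)"
proof -
  obtain N where N: "open N" "0 \<in> N" "\<And>t. t \<in> N \<Longrightarrow> c t \<in> U"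
    using smooth_curve_chart[OF A c U] by metis
  show ?thesis
    by (rule has_vector_derivative_transform_within_open
          [OF has_vector_derivative_compose[OF v K] N(1,2)])
       (simp add: inv_into_f_f[OF atlasD(1)[OF A U(1)] N(3)])
qed

lemma same_velocityD:
  assumes "same_velocity \<A> c d" "(U, f) \<in> \<A>" "c 0 \<in> U"
  obtains v where "((\<lambda>t. f (c t)) has_vector_derivative v) (at 0)"
    "((\<lambda>t. f (d t)) has_vector_derivative v) (at 0)"
  using assms unfolding same_velocity_def o_def by blast

lemma same_velocity_zero: "same_velocity \<A> c d \<Longrightarrow> c 0 = d 0 \<and> c 0 \<in> mcarrier \<A>"
  unfolding same_velocity_def by blast

text \<open>
  A smooth map preserves equality of velocities.  It suffices to know that the velocities agree in a
  single chart \<open>f\<close>; with \<open>F\<close> the identity this says that equality in one chart is equality in all.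
\<close>

lemma same_velocity_image:
  fixes c d :: "real \<Rightarrow> 'a" and \<A> :: "('a, 'e::real_normed_vector) atlas"
    and \<B> :: "('b, 'f::real_normed_vector) atlas"
  assumes A: "findim_atlas \<A>" and B: "findim_atlas \<B>"
    and c: "smooth_at vec_atlas \<A> c 0" and d: "smooth_at vec_atlas \<A> d 0"
    and F: "smooth_at \<A> \<B> F (c 0)"
    and U: "(U, f) \<in> \<A>" "c 0 \<in> U" and cd: "c 0 = d 0"
    and v: "((\<lambda>t. f (c t)) has_vector_derivative v) (at 0)"
      "((\<lambda>t. f (d t)) has_vector_derivative v) (at 0)"
  shows "same_velocity \<B> (\<lambda>t. F (c t)) (\<lambda>t. F (d t))"
  unfolding same_velocity_def o_def
proof (intro conjI)
  show "F (c 0) \<in> mcarrier \<B>" using smooth_at_mem(2)[OF A F] .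
  show "F (c 0) = F (d 0)" by (simp add: cd)
  have "\<exists>w. ((\<lambda>t. g (F (c t))) has_vector_derivative w) (at 0) \<and>
            ((\<lambda>t. g (F (d t))) has_vector_derivative w) (at 0)"
    if V: "(V, g) \<in> \<B>" "F (c 0) \<in> V" for V g
  proof -
    obtain K where K: "((\<lambda>y. g (F (inv_into U f y))) has_derivative K) (at (f (c 0)))"
      using smooth_at_chart_derivative[where F = F, OF A B F U V] .
    show ?thesis
      using chart_velocity_image[where F = F and c = c, OF A c U v(1) K]
        chart_velocity_image[where F = F and c = d,
          OF A d U(1) U(2)[unfolded cd] v(2) K[unfolded cd]] by blast
  qed
  thus "\<forall>(V, g)\<in>\<B>. F (c 0) \<in> V \<longrightarrow> (\<exists>w. ((\<lambda>t. g (F (c t))) has_vector_derivative w) (at 0) \<and>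
            ((\<lambda>t. g (F (d t))) has_vector_derivative w) (at 0))" by blast
qed

lemma same_velocity_trans:
  assumes "same_velocity \<A> c d" "same_velocity \<A> d e"
  shows "same_velocity \<A> c e"
  unfolding same_velocity_def o_def
proof (intro conjI)
  show "c 0 \<in> mcarrier \<A>" "c 0 = e 0"
    using assms[THEN same_velocity_zero] by auto
  have "\<exists>w. ((\<lambda>t. g (c t)) has_vector_derivative w) (at 0) \<and>
            ((\<lambda>t. g (e t)) has_vector_derivative w) (at 0)"
    if V: "(V, g) \<in> \<A>" "c 0 \<in> V" for V g
  proof -
    obtain v where v: "((\<lambda>t. g (c t)) has_vector_derivative v) (at 0)"
      "((\<lambda>t. g (d t)) has_vector_derivative v) (at 0)"
      using same_velocityD[OF assms(1) V] .
    have "d 0 \<in> V" using V(2) assms(1)[THEN same_velocity_zero] by simp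
    then obtain w where w: "((\<lambda>t. g (d t)) has_vector_derivative w) (at 0)"
      "((\<lambda>t. g (e t)) has_vector_derivative w) (at 0)"
      using same_velocityD[OF assms(2) V(1)] by metis
    show ?thesis using v w vector_derivative_unique_at[OF v(2) w(1)] by blast
  qed
  thus "\<forall>(V, g)\<in>\<A>. c 0 \<in> V \<longrightarrow> (\<exists>w. ((\<lambda>t. g (c t)) has_vector_derivative w) (at 0) \<and>
            ((\<lambda>t. g (e t)) has_vector_derivative w) (at 0))" by blast
qed

section \<open>Differentials of maps of Lie groups\<close>

lemma lie_groupD:
  assumes "lie_group L"
  shows "group L" "findim_atlas (atlas L)" "mcarrier (atlas L) = carrier L"
    "smooth_map (prod_atlas (atlas L) (atlas L)) (atlas L) (\<lambda>(x, y). x \<otimes>\<^bsub>L\<^esub> y)"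
    "smooth_map (atlas L) (atlas L) (\<lambda>x. inv\<^bsub>L\<^esub> x)"
    "smooth_map vec_atlas (atlas L) (lexp L)"
  using assms findim_atlas_smooth_manifold unfolding lie_group_def is_exponential_def by blast+

lemma lie_group_findim:
  fixes L :: "('a, 'e::real_normed_vector) liegrp"
  assumes "lie_group L"
  shows "finite_dimensional TYPE('e)"
  using lie_groupD(2)[OF assms] unfolding findim_atlas_def by blast

lemma lexp_carrier: "lie_group L \<Longrightarrow> lexp L Y \<in> carrier L"
  using smooth_map_carrier[OF lie_groupD(6), of L Y] lie_groupD(3)[of L] by (simp add: mcarrier_vec)

lemma lexp_zero:
  assumes L: "lie_group L"
  shows "lexp L 0 = \<one>\<^bsub>L\<^esub>"
proof -
  interpret group L using lie_groupD(1)[OF L] .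
  \<comment> \<open>the value at \<open>0\<close> of a one-parameter subgroup is idempotent\<close>
  have "lexp L ((0 + 0) *\<^sub>R 0) = lexp L (0 *\<^sub>R 0) \<otimes>\<^bsub>L\<^esub> lexp L (0 *\<^sub>R 0)"
    using L unfolding lie_group_def is_exponential_def by blast
  hence "lexp L 0 = lexp L 0 \<otimes>\<^bsub>L\<^esub> lexp L 0" by simp
  thus ?thesis using lexp_carrier[OF L, of 0] by (metis r_cancel_one)
qed

lemma one_parameter_smooth:
  fixes L :: "('a, 'e::real_normed_vector) liegrp"
  assumes L: "lie_group L"
  shows "smooth_map vec_atlas (atlas L) (\<lambda>t::real. lexp L (t *\<^sub>R Y))"
proof -
  note fd = lie_group_findim[OF L]
  have 1: "smooth_map vec_atlas vec_atlas (\<lambda>t::real. t *\<^sub>R Y)"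
    by (rule smooth_map_vec[OF finite_dimensional_real fd
          smooth_on_bounded_linear[OF open_UNIV bounded_linear_scaleR_left]])
  show ?thesis
    by (rule smooth_map_compose[where F = "\<lambda>t::real. t *\<^sub>R Y" and G = "lexp L",
          OF findim_atlas_vec[OF finite_dimensional_real] findim_atlas_vec[OF fd] lie_groupD(2)[OF L]
            1 lie_groupD(6)[OF L]])
qed

text \<open>
  A chart at the unit together with the differential \<open>D\<close> of the exponential map in this chart, which
  identifies the Lie algebra with the tangent space at the unit.
\<close>

definition exp_chart :: "('a, 'e::real_normed_vector) liegrp \<Rightarrow> 'a set \<Rightarrow> ('a \<Rightarrow> 'e) \<Rightarrow> ('e \<Rightarrow> 'e) \<Rightarrow> bool" where
  "exp_chart L U f D \<longleftrightarrow> (U, f) \<in> atlas L \<and> \<one>\<^bsub>L\<^esub> \<in> U \<and> linear D \<and> bij D \<and>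
     (\<forall>Z. ((\<lambda>t. f (lexp L (t *\<^sub>R Z))) has_vector_derivative D Z) (at 0))"

lemma exp_chart_exists:
  assumes L: "lie_group L"
  obtains U f D where "exp_chart L U f D"
proof -
  interpret group L using lie_groupD(1)[OF L] .
  have "\<one>\<^bsub>L\<^esub> \<in> mcarrier (atlas L)" using lie_groupD(3)[OF L] by simp
  then obtain U f where U: "(U, f) \<in> atlas L" "\<one>\<^bsub>L\<^esub> \<in> U" by (rule mcarrierE)
  have "\<forall>(U, f)\<in>atlas L. \<one>\<^bsub>L\<^esub> \<in> U \<longrightarrow> (\<exists>D. ((f \<circ> lexp L) has_derivative D) (at 0) \<and> bij D)"
    using L unfolding lie_group_def is_exponential_def by blast
  then obtain D where D: "((f \<circ> lexp L) has_derivative D) (at 0)" "bij D"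
    using U by blast
  have "((\<lambda>t. f (lexp L (t *\<^sub>R Z))) has_vector_derivative D Z) (at 0)" for Z
  proof -
    have 1: "((\<lambda>t::real. t *\<^sub>R Z) has_vector_derivative Z) (at 0)"
      by (auto intro!: derivative_eq_intros)
    show ?thesis
      using has_vector_derivative_compose[OF 1, of "f \<circ> lexp L" D] D(1) by simp
  qed
  hence "exp_chart L U f D"
    unfolding exp_chart_def using U D(2) has_derivative_linear[OF D(1)] by blast
  thus ?thesis by (rule that)
qed

lemma linear_inv_bij:
  fixes D :: "'e::real_vector \<Rightarrow> 'f::real_vector"
  assumes "linear D" "bij D"
  shows "linear (inv_into UNIV D)"
proof (rule linearI)
  have i: "inv_into UNIV D (D x) = x" and s: "D (inv_into UNIV D y) = y" for x y
    using assms(2) by (simp_all add: bij_is_inj bij_is_surj surj_f_inv_f)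
  show "inv_into UNIV D (x + y) = inv_into UNIV D x + inv_into UNIV D y" for x y
    using i[of "inv_into UNIV D x + inv_into UNIV D y"] by (simp only: linear_add[OF assms(1)] s)
  show "inv_into UNIV D (r *\<^sub>R x) = r *\<^sub>R inv_into UNIV D x" for r x
    using i[of "r *\<^sub>R inv_into UNIV D x"] by (simp only: linear_cmul[OF assms(1)] s)
qed

text \<open>
  Existence and uniqueness of the element of the Lie algebra that represents the velocity of a curve
  through the unit: both follow from bijectivity of \<open>D\<close>.
\<close>

lemma same_velocity_lexp_iff:
  fixes c :: "real \<Rightarrow> 'a" and L :: "('a, 'e::real_normed_vector) liegrp"
  assumes L: "lie_group L" and E: "exp_chart L U f D"
    and c: "smooth_at vec_atlas (atlas L) c 0" "c 0 = \<one>\<^bsub>L\<^esub>"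
    and v: "((\<lambda>t. f (c t)) has_vector_derivative v) (at 0)"
  shows "same_velocity (atlas L) c (\<lambda>t. lexp L (t *\<^sub>R Z)) \<longleftrightarrow> Z = inv_into UNIV D v"
proof
  have U: "(U, f) \<in> atlas L" "c 0 \<in> U" and D: "bij D"
    and e: "((\<lambda>t. f (lexp L (t *\<^sub>R Z))) has_vector_derivative D Z) (at 0)" for Z
    using E c(2) unfolding exp_chart_def by auto
  note A = lie_groupD(2)[OF L]
  {
    assume "same_velocity (atlas L) c (\<lambda>t. lexp L (t *\<^sub>R Z))"
    then obtain w where w: "((\<lambda>t. f (c t)) has_vector_derivative w) (at 0)"
      "((\<lambda>t. f (lexp L (t *\<^sub>R Z))) has_vector_derivative w) (at 0)"
      by (rule same_velocityD[where c = c, OF _ U])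
    have "v = w" "w = D Z"
      using vector_derivative_unique_at v w e by blast+
    thus "Z = inv_into UNIV D v" using D by (simp add: bij_is_inj)
  }
  assume "Z = inv_into UNIV D v"
  hence Z: "D Z = v" using D by (simp add: bij_is_surj surj_f_inv_f)
  have sm: "smooth_at vec_atlas (atlas L) (\<lambda>t::real. lexp L (t *\<^sub>R Z)) 0"
    by (rule smooth_map_at[OF findim_atlas_vec[OF finite_dimensional_real] A one_parameter_smooth[OF L]])
       (simp add: mcarrier_vec)
  have id: "smooth_at (atlas L) (atlas L) (\<lambda>x. x) (c 0)"
    by (rule smooth_at_ident[OF A mcarrierI[OF U]])
  have "c 0 = lexp L (0 *\<^sub>R Z)" using c(2) lexp_zero[OF L] by simp
  from same_velocity_image[where F = "\<lambda>x. x", OF A A c(1) sm id U this v e[of Z, unfolded Z]]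
  show "same_velocity (atlas L) c (\<lambda>t. lexp L (t *\<^sub>R Z))" .
qed

lemma image_one_parameter_smooth:
  fixes K :: "('a, 'e::real_normed_vector) liegrp" and L :: "('b, 'f::real_normed_vector) liegrp"
  assumes K: "lie_group K" and L: "lie_group L" and F: "smooth_map (atlas K) (atlas L) F"
  shows "smooth_at vec_atlas (atlas L) (\<lambda>t::real. F (lexp K (t *\<^sub>R Y))) 0"
  by (rule smooth_map_at[OF _ _ smooth_map_compose[where F = "\<lambda>t. lexp K (t *\<^sub>R Y)" and G = F,
        OF _ lie_groupD(2)[OF K] _ one_parameter_smooth[OF K] F]])
     (simp_all add: findim_atlas_vec finite_dimensional_real lie_groupD(2)[OF L] mcarrier_vec)

lemma lie_diff_chart:
  fixes K :: "('a, 'e::real_normed_vector) liegrp" and L :: "('b, 'f::real_normed_vector) liegrp"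
  assumes K: "lie_group K" and L: "lie_group L" and F: "smooth_map (atlas K) (atlas L) F"
    and one: "F \<one>\<^bsub>K\<^esub> = \<one>\<^bsub>L\<^esub>" and E: "exp_chart L V g D"
    and v: "((\<lambda>t. g (F (lexp K (t *\<^sub>R Y)))) has_vector_derivative v) (at 0)"
  shows "lie_diff K L F Y = inv_into UNIV D v"
proof -
  have "F (lexp K (0 *\<^sub>R Y)) = \<one>\<^bsub>L\<^esub>" using lexp_zero[OF K] one by simp
  from same_velocity_lexp_iff[OF L E image_one_parameter_smooth[OF K L F] this v]
  show ?thesis unfolding lie_diff_def by simp
qed

lemma same_velocity_lie_diff_iff:
  fixes K :: "('a, 'e::real_normed_vector) liegrp" and L :: "('b, 'f::real_normed_vector) liegrp"
  assumes K: "lie_group K" and L: "lie_group L" and F: "smooth_map (atlas K) (atlas L) F"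
    and one: "F \<one>\<^bsub>K\<^esub> = \<one>\<^bsub>L\<^esub>"
  shows "same_velocity (atlas L) (\<lambda>t. F (lexp K (t *\<^sub>R Y))) (\<lambda>t. lexp L (t *\<^sub>R Z)) \<longleftrightarrow>
         lie_diff K L F Y = Z"
proof -
  obtain V g D where E: "exp_chart L V g D" using exp_chart_exists[OF L] .
  have F0: "F (lexp K (0 *\<^sub>R Y)) = \<one>\<^bsub>L\<^esub>" using lexp_zero[OF K] one by simp
  have V: "(V, g) \<in> atlas L" "F (lexp K (0 *\<^sub>R Y)) \<in> V"
    using E F0 unfolding exp_chart_def by auto
  obtain v where v: "((\<lambda>t. g (F (lexp K (t *\<^sub>R Y)))) has_vector_derivative v) (at 0)"
    using smooth_curve_velocity[OF lie_groupD(2)[OF L] image_one_parameter_smooth[OF K L F] V] .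
  show ?thesis
    using same_velocity_lexp_iff[OF L E image_one_parameter_smooth[OF K L F] F0 v]
      lie_diff_chart[OF K L F one E v] by auto
qed

text \<open>
  In charts at the units the differential is \<open>D\<^sup>-\<^sup>1 \<circ> k \<circ> C\<close>, where \<open>k\<close> is the derivative of the coordinate
  representation of \<open>F\<close>, and \<open>C\<close>, \<open>D\<close> are the differentials of the two exponential maps.
\<close>

lemma lie_diff_bounded_linear:
  fixes K :: "('a, 'e::real_normed_vector) liegrp" and L :: "('b, 'f::real_normed_vector) liegrp"
  assumes K: "lie_group K" and L: "lie_group L" and F: "smooth_map (atlas K) (atlas L) F"
    and one: "F \<one>\<^bsub>K\<^esub> = \<one>\<^bsub>L\<^esub>"
  shows "bounded_linear (lie_diff K L F)"
proof -
  obtain V g D where E: "exp_chart L V g D" using exp_chart_exists[OF L] .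
  obtain U f C where C: "exp_chart K U f C" using exp_chart_exists[OF K] .
  interpret K: group K using lie_groupD(1)[OF K] .
  note A = lie_groupD(2)[OF K] and B = lie_groupD(2)[OF L]
  have V: "(V, g) \<in> atlas L" "F \<one>\<^bsub>K\<^esub> \<in> V" and D: "linear D" "bij D"
    using E one unfolding exp_chart_def by auto
  have U: "(U, f) \<in> atlas K" "\<one>\<^bsub>K\<^esub> \<in> U" and linC: "linear C"
    and e: "((\<lambda>t. f (lexp K (t *\<^sub>R Y))) has_vector_derivative C Y) (at 0)" for Y
    using C unfolding exp_chart_def by auto
  have "smooth_at (atlas K) (atlas L) F \<one>\<^bsub>K\<^esub>"
    by (rule smooth_map_at[OF A B F mcarrierI[OF U]])
  then obtain k where k: "((\<lambda>y. g (F (inv_into U f y))) has_derivative k) (at (f \<one>\<^bsub>K\<^esub>))"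
    using smooth_at_chart_derivative[where F = F, OF A B _ U V] by blast
  have l0: "lexp K (0 *\<^sub>R Y) = \<one>\<^bsub>K\<^esub>" for Y using lexp_zero[OF K] by simp
  have sm: "smooth_at vec_atlas (atlas K) (\<lambda>t::real. lexp K (t *\<^sub>R Y)) 0" for Y
    by (rule smooth_map_at[OF findim_atlas_vec[OF finite_dimensional_real] A one_parameter_smooth[OF K]])
       (simp add: mcarrier_vec)
  have "lie_diff K L F Y = inv_into UNIV D (k (C Y))" for Y
  proof (rule lie_diff_chart[OF K L F one E])
    show "((\<lambda>t. g (F (lexp K (t *\<^sub>R Y)))) has_vector_derivative k (C Y)) (at 0)"
      by (rule chart_velocity_image[where F = F and c = "\<lambda>t. lexp K (t *\<^sub>R Y)", OF A sm U(1) _ e])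
         (simp_all only: l0 U k)
  qed
  hence "lie_diff K L F = inv_into UNIV D \<circ> (k \<circ> C)" by auto
  moreover have "linear \<dots>"
    by (intro linear_compose linC has_derivative_linear[OF k] linear_inv_bij[OF D])
  ultimately show ?thesis
    using finite_dimensional_bounded_linear[OF lie_group_findim[OF K]] by metis
qed

text \<open>
  The chain rule.  By definition \<open>F (exp tY)\<close> has the velocity of a one-parameter subgroup of \<open>L\<close>; apply
  \<open>G\<close> to both curves.
\<close>

lemma lie_diff_compose:
  fixes K :: "('a, 'e::real_normed_vector) liegrp" and L :: "('b, 'f::real_normed_vector) liegrp"
    and M :: "('c, 'd::real_normed_vector) liegrp"
  assumes K: "lie_group K" and L: "lie_group L" and M: "lie_group M"
    and F: "smooth_map (atlas K) (atlas L) F" "F \<one>\<^bsub>K\<^esub> = \<one>\<^bsub>L\<^esub>"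
    and G: "smooth_map (atlas L) (atlas M) G" "G \<one>\<^bsub>L\<^esub> = \<one>\<^bsub>M\<^esub>"
  shows "lie_diff K M (\<lambda>x. G (F x)) Y = lie_diff L M G (lie_diff K L F Y)"
proof -
  note A = lie_groupD(2)[OF K] and B = lie_groupD(2)[OF L] and C = lie_groupD(2)[OF M]
  let ?c = "\<lambda>t::real. F (lexp K (t *\<^sub>R Y))" and ?d = "\<lambda>t::real. lexp L (t *\<^sub>R lie_diff K L F Y)"
  have v1: "same_velocity (atlas L) ?c ?d"
    using same_velocity_lie_diff_iff[OF K L F] by blast
  have v2: "same_velocity (atlas M) (\<lambda>t. G (?d t))
      (\<lambda>t. lexp M (t *\<^sub>R lie_diff L M G (lie_diff K L F Y)))"
    using same_velocity_lie_diff_iff[OF L M G] by blast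
  have c: "smooth_at vec_atlas (atlas L) ?c 0"
    by (rule image_one_parameter_smooth[OF K L F(1)])
  have d: "smooth_at vec_atlas (atlas L) ?d 0"
    by (rule smooth_map_at[OF findim_atlas_vec[OF finite_dimensional_real] B one_parameter_smooth[OF L]])
       (simp add: mcarrier_vec)
  have c0: "?c 0 \<in> mcarrier (atlas L)" and cd: "?c 0 = ?d 0"
    using same_velocity_zero[OF v1] by auto
  obtain U f where U: "(U, f) \<in> atlas L" "?c 0 \<in> U" using c0 by (rule mcarrierE)
  obtain v where v: "((\<lambda>t. f (?c t)) has_vector_derivative v) (at 0)"
      "((\<lambda>t. f (?d t)) has_vector_derivative v) (at 0)"
    using same_velocityD[OF v1 U] .
  have "same_velocity (atlas M) (\<lambda>t. G (?c t)) (\<lambda>t. G (?d t))"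
    by (rule same_velocity_image[where F = G, OF B C c d smooth_map_at[OF B C G(1) c0] U cd v])
  from same_velocity_trans[OF this v2]
  have "same_velocity (atlas M) (\<lambda>t. G (F (lexp K (t *\<^sub>R Y))))
      (\<lambda>t. lexp M (t *\<^sub>R lie_diff L M G (lie_diff K L F Y)))" .
  moreover have "G (F \<one>\<^bsub>K\<^esub>) = \<one>\<^bsub>M\<^esub>" using F(2) G(2) by simp
  ultimately show ?thesis
    using same_velocity_lie_diff_iff[where F = "\<lambda>x. G (F x)", OF K M
        smooth_map_compose[where F = F and G = G, OF A B C F(1) G(1)]] by blast
qed

section \<open>The adjoint and coadjoint actions\<close>

lemma smooth_map_mult:
  assumes L: "lie_group L" and A: "findim_atlas \<A>"
    and F: "smooth_map \<A> (atlas L) F" and G: "smooth_map \<A> (atlas L) G"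
  shows "smooth_map \<A> (atlas L) (\<lambda>x. F x \<otimes>\<^bsub>L\<^esub> G x)"
proof -
  note B = lie_groupD(2)[OF L]
  have "smooth_map \<A> (prod_atlas (atlas L) (atlas L)) (\<lambda>x. (F x, G x))"
    by (rule smooth_map_Pair[OF A B B F G])
  from smooth_map_compose[OF A findim_atlas_prod[OF B B] B this lie_groupD(4)[OF L]]
  show ?thesis by simp
qed

lemma smooth_map_inv:
  assumes L: "lie_group L" and A: "findim_atlas \<A>" and F: "smooth_map \<A> (atlas L) F"
  shows "smooth_map \<A> (atlas L) (\<lambda>x. inv\<^bsub>L\<^esub> F x)"
  by (rule smooth_map_compose[where F = F and G = "\<lambda>x. inv\<^bsub>L\<^esub> x",
        OF A lie_groupD(2)[OF L] lie_groupD(2)[OF L] F lie_groupD(5)[OF L]])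

lemma conjugation_smooth:
  assumes L: "lie_group L" and h: "h \<in> carrier L"
  shows "smooth_map (atlas L) (atlas L) (\<lambda>y. h \<otimes>\<^bsub>L\<^esub> y \<otimes>\<^bsub>L\<^esub> inv\<^bsub>L\<^esub> h)"
proof -
  note A = lie_groupD(2)[OF L]
  interpret group L using lie_groupD(1)[OF L] .
  have c: "smooth_map (atlas L) (atlas L) (\<lambda>_. k)" if "k \<in> carrier L" for k
    by (rule smooth_map_const[OF A A]) (simp add: lie_groupD(3)[OF L] that)
  show ?thesis
    by (intro smooth_map_mult[OF L A] smooth_map_ident[OF A] c h inv_closed)
qed

lemma conjugation_one:
  assumes "group L" "h \<in> carrier L"
  shows "h \<otimes>\<^bsub>L\<^esub> \<one>\<^bsub>L\<^esub> \<otimes>\<^bsub>L\<^esub> inv\<^bsub>L\<^esub> h = \<one>\<^bsub>L\<^esub>"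
proof -
  interpret group L by fact
  show ?thesis using assms(2) by simp
qed

lemma Ad_bounded_linear:
  assumes L: "lie_group L" and h: "h \<in> carrier L"
  shows "bounded_linear (Ad L h)"
  unfolding Ad_def
  by (rule lie_diff_bounded_linear[OF L L conjugation_smooth[OF L h] conjugation_one[OF lie_groupD(1)[OF L] h]])

lemma Ad_one:
  assumes L: "lie_group L"
  shows "Ad L \<one>\<^bsub>L\<^esub> Y = Y"
proof -
  interpret group L using lie_groupD(1)[OF L] .
  note A = lie_groupD(2)[OF L]
  have eq: "\<one>\<^bsub>L\<^esub> \<otimes>\<^bsub>L\<^esub> lexp L Y \<otimes>\<^bsub>L\<^esub> inv\<^bsub>L\<^esub> \<one>\<^bsub>L\<^esub> = lexp L Y" for Y
    using lexp_carrier[OF L, of Y] by simp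
  obtain U f D where E: "exp_chart L U f D" using exp_chart_exists[OF L] .
  hence D: "bij D" and e: "((\<lambda>t. f (lexp L (t *\<^sub>R Y))) has_vector_derivative D Y) (at 0)"
    unfolding exp_chart_def by auto
  have "Ad L \<one>\<^bsub>L\<^esub> Y = inv_into UNIV D (D Y)"
    unfolding Ad_def
    by (rule lie_diff_chart[OF L L conjugation_smooth[OF L one_closed]
          conjugation_one[OF lie_groupD(1)[OF L] one_closed] E]) (simp only: eq e)
  thus ?thesis using D by (simp add: bij_is_inj)
qed

text \<open>
  Conjugation by \<open>h k\<close> is conjugation by \<open>k\<close> followed by conjugation by \<open>h\<close>.
\<close>

lemma Ad_mult:
  assumes L: "lie_group L" and h: "h \<in> carrier L" and k: "k \<in> carrier L"
  shows "Ad L (h \<otimes>\<^bsub>L\<^esub> k) Y = Ad L h (Ad L k Y)"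
proof -
  interpret group L using lie_groupD(1)[OF L] .
  have eq: "(h \<otimes>\<^bsub>L\<^esub> k) \<otimes>\<^bsub>L\<^esub> lexp L Z \<otimes>\<^bsub>L\<^esub> inv\<^bsub>L\<^esub> (h \<otimes>\<^bsub>L\<^esub> k) =
      h \<otimes>\<^bsub>L\<^esub> (k \<otimes>\<^bsub>L\<^esub> lexp L Z \<otimes>\<^bsub>L\<^esub> inv\<^bsub>L\<^esub> k) \<otimes>\<^bsub>L\<^esub> inv\<^bsub>L\<^esub> h" for Z
    using h k lexp_carrier[OF L, of Z] by (simp add: inv_mult_group m_assoc)
  have "Ad L (h \<otimes>\<^bsub>L\<^esub> k) Y =
      lie_diff L L (\<lambda>y. h \<otimes>\<^bsub>L\<^esub> (k \<otimes>\<^bsub>L\<^esub> y \<otimes>\<^bsub>L\<^esub> inv\<^bsub>L\<^esub> k) \<otimes>\<^bsub>L\<^esub> inv\<^bsub>L\<^esub> h) Y"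
    unfolding Ad_def lie_diff_def by (simp only: eq)
  also have "\<dots> = Ad L h (Ad L k Y)"
    unfolding Ad_def
    by (rule lie_diff_compose[where F = "\<lambda>y. k \<otimes>\<^bsub>L\<^esub> y \<otimes>\<^bsub>L\<^esub> inv\<^bsub>L\<^esub> k" and
          G = "\<lambda>y. h \<otimes>\<^bsub>L\<^esub> y \<otimes>\<^bsub>L\<^esub> inv\<^bsub>L\<^esub> h", OF L L L
          conjugation_smooth[OF L k] conjugation_one[OF lie_groupD(1)[OF L] k]
          conjugation_smooth[OF L h] conjugation_one[OF lie_groupD(1)[OF L] h]])
  finally show ?thesis .
qed

text \<open>
  In coordinates, \<open>Ad\<^sub>h Y\<close> is \<open>D\<^sup>-\<^sup>1\<close> of the partial derivative at \<open>t = 0\<close> of the smooth function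
  \<open>(h, t) \<mapsto> h exp(tY) h\<^sup>-\<^sup>1\<close>.
\<close>

lemma Ad_smooth:
  fixes L :: "('a, 'e::real_normed_vector) liegrp"
  assumes L: "lie_group L"
  shows "smooth_map (atlas L) vec_atlas (\<lambda>h. Ad L h Y)"
proof -
  interpret group L using lie_groupD(1)[OF L] .
  note A = lie_groupD(2)[OF L] and fd = lie_group_findim[OF L]
  note R = findim_atlas_vec[OF finite_dimensional_real]
  note P = findim_atlas_prod[OF A R]
  obtain V g D where E: "exp_chart L V g D" using exp_chart_exists[OF L] .
  hence V: "(V, g) \<in> atlas L" "\<one>\<^bsub>L\<^esub> \<in> V" and D: "linear D" "bij D"
    unfolding exp_chart_def by auto
  let ?M = "\<lambda>z :: 'a \<times> real. fst z \<otimes>\<^bsub>L\<^esub> lexp L (snd z *\<^sub>R Y) \<otimes>\<^bsub>L\<^esub> inv\<^bsub>L\<^esub> (fst z)"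
  have M: "smooth_map (prod_atlas (atlas L) vec_atlas) (atlas L) ?M"
    by (intro smooth_map_mult[OF L P] smooth_map_inv[OF L P] smooth_map_fst[OF A R]
        smooth_map_compose[where F = snd and G = "\<lambda>t. lexp L (t *\<^sub>R Y)", OF P R A
          smooth_map_snd[OF A R] one_parameter_smooth[OF L]])
  show ?thesis
    unfolding smooth_map_iff_smooth_at[OF A findim_atlas_vec[OF fd]]
  proof
    fix h assume h: "h \<in> mcarrier (atlas L)"
    then obtain U f where U: "(U, f) \<in> atlas L" "h \<in> U" by (rule mcarrierE)
    have hc: "h \<in> carrier L" using h lie_groupD(3)[OF L] by simp
    note inj = atlasD(1)[OF A U(1)]
    let ?U = "U \<times> (UNIV :: real set)" and ?f = "map_prod f (id :: real \<Rightarrow> real)"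
    let ?i = "inv_into U f"
    have "smooth_in_charts ?U ?f V g ?M (h, 0)"
    proof (rule smooth_at_charts[where F = ?M, OF P A _ prod_atlasI[OF U(1) vec_chart] _ V(1)])
      show "smooth_at (prod_atlas (atlas L) vec_atlas) (atlas L) ?M (h, 0)"
        by (rule smooth_map_at[OF P A M]) (simp add: mcarrier_prod mcarrier_vec h)
      show "?M (h, 0) \<in> V" using lexp_zero[OF L] hc V(2) by simp
    qed (use U in simp)
    then obtain N where N: "open N" "(f h, 0) \<in> N" "N \<subseteq> ?f ` ?U"
        "smooth_on N (\<lambda>y. g (?M (inv_into ?U ?f y)))"
      unfolding smooth_in_charts_def by auto
    have Nf: "fst z \<in> f ` U" if "z \<in> N" for z using that N(3) by auto
    let ?m = "\<lambda>z. g (?M (?i (fst z), snd z))"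
    have inv: "inv_into ?U ?f z = (?i (fst z), snd z)" if "z \<in> N" for z
      using inv_into_map_prod[OF inj inj_on_id, of "fst z" "snd z" UNIV] Nf[OF that] by simp
    have m: "smooth_on N ?m"
      using N(4) inv smooth_on_cong[OF N(1), of "\<lambda>y. g (?M (inv_into ?U ?f y))" ?m] by simp
    \<comment> \<open>\<open>?m\<close> is the conjugated one-parameter subgroup in coordinates; \<open>?d\<close> is its derivative along \<open>t\<close>\<close>
    let ?N = "{y. (y, 0) \<in> N}"
    have opN: "open ?N"
    proof -
      have "?N = (\<lambda>y. (y, 0)) -` N" by auto
      moreover have "open ((\<lambda>y. (y, 0)) -` N)"
        by (intro open_vimage N(1) continuous_intros)
      ultimately show ?thesis by simp
    qed
    let ?d = "\<lambda>y. frechet_derivative ?m (at (y, 0)) (0, 1)"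
    have Ad: "Ad L (?i y) Y = inv_into UNIV D (?d y)" if y: "y \<in> ?N" for y
    proof -
      have y': "(y, 0) \<in> N" using y by simp
      hence iy: "?i y \<in> carrier L"
        using Nf[OF y'] U(1) lie_groupD(3)[OF L] mcarrierI[OF U(1)] by (auto simp: inv_into_into)
      have 1: "((\<lambda>t. (y, t)) has_vector_derivative (0, 1)) (at (0::real))"
        by (auto intro!: derivative_eq_intros)
      have "((\<lambda>t. ?m (y, t)) has_vector_derivative ?d y) (at 0)"
        by (rule has_vector_derivative_compose[OF 1 smooth_on_frechet_derivative(1)[OF m y']])
      hence v: "((\<lambda>t. g (?i y \<otimes>\<^bsub>L\<^esub> lexp L (t *\<^sub>R Y) \<otimes>\<^bsub>L\<^esub> inv\<^bsub>L\<^esub> (?i y)))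
          has_vector_derivative ?d y) (at 0)" by simp
      show ?thesis
        unfolding Ad_def
        by (rule lie_diff_chart[OF L L conjugation_smooth[OF L iy]
              conjugation_one[OF lie_groupD(1)[OF L] iy] E v])
    qed
    have incl: "smooth_on ?N (\<lambda>y::'e. (y, 0::real))"
      by (rule smooth_on_Pair[OF opN smooth_on_bounded_linear[OF opN bounded_linear_ident]
            smooth_on_bounded_linear[OF opN bounded_linear_zero]])
    have d: "smooth_on ?N ?d"
      by (rule smooth_on_compose[where f = "\<lambda>y. (y, 0)" and
            g = "\<lambda>z. frechet_derivative ?m (at z) (0, 1)",
            OF finite_dimensional_prod[OF fd finite_dimensional_real] opN N(1) _ incl
              smooth_on_frechet_derivative(2)[OF m]]) simp
    have "smooth_on ?N (\<lambda>y. inv_into UNIV D (?d y))"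
      by (rule smooth_on_compose[where g = "inv_into UNIV D", OF fd opN open_UNIV _ d
            smooth_on_bounded_linear[OF open_UNIV
              finite_dimensional_bounded_linear[OF fd linear_inv_bij[OF D]]]]) simp
    hence "smooth_on ?N (\<lambda>y. Ad L (?i y) Y)"
      using smooth_on_cong[OF opN, of "\<lambda>y. Ad L (?i y) Y" "\<lambda>y. inv_into UNIV D (?d y)"] Ad by simp
    hence "smooth_in_charts U f UNIV id (\<lambda>h. Ad L h Y) h"
      unfolding smooth_in_charts_def using opN N(2) U(2) Nf
      by (intro conjI exI[of _ ?N]) auto
    thus "smooth_at (atlas L) vec_atlas (\<lambda>h. Ad L h Y) h"
      by (rule smooth_atI[OF U(1) vec_chart])
  qed
qed

lemma Ad_star_apply:
  assumes "lie_group L" "h \<in> carrier L"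
  shows "blinfun_apply (Ad_star L h p) Y = blinfun_apply p (Ad L h Y)"
  unfolding transp_def
  by (rule bounded_linear_Blinfun_apply[THEN fun_cong])
     (rule bounded_linear_compose[OF blinfun.bounded_linear_right Ad_bounded_linear[OF assms]])

lemma Ad_star_add:
  assumes "lie_group L" "h \<in> carrier L"
  shows "Ad_star L h (p + q) = Ad_star L h p + Ad_star L h q"
  by (rule blinfun_eqI) (simp add: Ad_star_apply[OF assms] blinfun.add_left)

lemma Ad_star_one:
  assumes "lie_group L"
  shows "Ad_star L \<one>\<^bsub>L\<^esub> p = p"
proof -
  interpret group L using lie_groupD(1)[OF assms] .
  show ?thesis by (rule blinfun_eqI) (simp add: Ad_star_apply[OF assms] Ad_one[OF assms])
qed

lemma Ad_star_mult:
  assumes L: "lie_group L" and h: "h \<in> carrier L" and k: "k \<in> carrier L"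
  shows "Ad_star L (h \<otimes>\<^bsub>L\<^esub> k) p = Ad_star L k (Ad_star L h p)"
proof -
  interpret group L using lie_groupD(1)[OF L] .
  show ?thesis
    by (rule blinfun_eqI) (simp add: Ad_star_apply[OF L] h k Ad_mult[OF L h k])
qed

text \<open>
  If \<open>c\<^sub>b\<close> are the coordinates with respect to a basis \<open>B\<close> of the Lie algebra, then
  \<open>Ad\<^sup>*\<^sub>k q = \<Sum>b\<in>B. q(Ad\<^sub>k b) c\<^sub>b\<close>, a sum of products of smooth functions with constants.
\<close>

lemma Ad_star_smooth:
  fixes L :: "('b, 'e::real_normed_vector) liegrp" and p :: "'a \<Rightarrow> 'e dual"
  assumes L: "lie_group L" and A: "findim_atlas \<A>"
    and h: "smooth_map \<A> (atlas L) h" and p: "smooth_map \<A> vec_atlas p"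
  shows "smooth_map \<A> vec_atlas (\<lambda>x. Ad_star L (h x) (p x))"
proof -
  note fd = lie_group_findim[OF L]
  note fd' = finite_dimensional_dual[OF fd] and fr = finite_dimensional_real
  obtain B :: "'e set" and c where B: "finite B" "\<And>b. bounded_linear (c b)"
      "\<And>v. (\<Sum>b\<in>B. c b v *\<^sub>R b) = v"
    using finite_dimensional_coordinates[OF fd] by metis
  have coord: "Ad_star L k q = (\<Sum>b\<in>B. blinfun_apply q (Ad L k b) *\<^sub>R Blinfun (c b))"
    if k: "k \<in> carrier L" for k q
  proof (rule blinfun_eqI)
    fix Y
    have lin: "linear (\<lambda>Y. blinfun_apply q (Ad L k Y))"
      using bounded_linear_compose[OF blinfun.bounded_linear_right Ad_bounded_linear[OF L k]]
      by (rule bounded_linear.linear)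
    have "blinfun_apply (Ad_star L k q) Y = blinfun_apply q (Ad L k (\<Sum>b\<in>B. c b Y *\<^sub>R b))"
      by (simp add: Ad_star_apply[OF L k] B(3))
    also have "\<dots> = (\<Sum>b\<in>B. c b Y *\<^sub>R blinfun_apply q (Ad L k b))"
      by (simp add: linear_sum[OF lin] linear_cmul[OF lin])
    also have "\<dots> = blinfun_apply (\<Sum>b\<in>B. blinfun_apply q (Ad L k b) *\<^sub>R Blinfun (c b)) Y"
      unfolding blinfun.sum_left
      by (simp add: blinfun.scaleR_left bounded_linear_Blinfun_apply B(2) mult.commute)
    finally show "blinfun_apply (Ad_star L k q) Y =
        blinfun_apply (\<Sum>b\<in>B. blinfun_apply q (Ad L k b) *\<^sub>R Blinfun (c b)) Y" .
  qed
  have "smooth_map \<A> vec_atlas (\<lambda>x. Ad L (h x) b)" for b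
    by (rule smooth_map_compose[where F = h and G = "\<lambda>h. Ad L h b",
          OF A lie_groupD(2)[OF L] findim_atlas_vec[OF fd] h Ad_smooth[OF L]])
  from smooth_map_bilinear[OF A bounded_bilinear_blinfun_apply fd' fd fr p this]
  have pair: "smooth_map \<A> vec_atlas (\<lambda>x. blinfun_apply (p x) (Ad L (h x) b))" for b .
  have const: "smooth_map \<A> vec_atlas (\<lambda>_. q)" for q :: "'e dual"
    by (rule smooth_map_const[OF A findim_atlas_vec[OF fd']]) (simp add: mcarrier_vec)
  have "smooth_map \<A> vec_atlas (\<lambda>x. \<Sum>b\<in>B. blinfun_apply (p x) (Ad L (h x) b) *\<^sub>R Blinfun (c b))"
    by (rule smooth_map_sum[OF A fd'])
       (rule smooth_map_bilinear[OF A bounded_bilinear_scaleR fr fd' fd' pair const])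
  thus ?thesis
  proof (rule smooth_map_cong[OF A findim_atlas_vec[OF fd']])
    fix x assume "x \<in> mcarrier \<A>"
    hence "h x \<in> carrier L" using smooth_map_carrier[OF h] lie_groupD(3)[OF L] by blast
    thus "(\<Sum>b\<in>B. blinfun_apply (p x) (Ad L (h x) b) *\<^sub>R Blinfun (c b)) = Ad_star L (h x) (p x)"
      by (rule coord[symmetric])
  qed
qed

section \<open>The dressing actions on double translates by elements of H\<close>

context poisson_lie_setting
begin

sublocale G: group G using lie_groupD(1)[OF G(1)] .

lemma lie_group_H: "lie_group H"
  using H(1) unfolding lie_subgroup_def by blast

sublocale H: group H using lie_groupD(1)[OF lie_group_H] .

lemma lie_group_Gs: "lie_group Gs"
  using dual unfolding dual_poisson_lie_group_def poisson_lie_group_def by blast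

sublocale Gs: group Gs using lie_groupD(1)[OF lie_group_Gs] .

lemma H_subset: "h \<in> carrier H \<Longrightarrow> h \<in> carrier G"
  using H(1) subgroup.subset unfolding lie_subgroup_def by blast

lemma H_one: "\<one>\<^bsub>H\<^esub> = \<one>\<^bsub>G\<^esub>"
  using H(1) unfolding lie_subgroup_def by blast

lemma H_mult: "h \<in> carrier H \<Longrightarrow> k \<in> carrier H \<Longrightarrow> h \<otimes>\<^bsub>H\<^esub> k = h \<otimes>\<^bsub>G\<^esub> k"
  using H(1) unfolding lie_subgroup_def by blast

lemma H_inv:
  assumes "h \<in> carrier H"
  shows "inv\<^bsub>H\<^esub> h = inv\<^bsub>G\<^esub> h"
proof (rule G.inv_equality[symmetric])
  show "inv\<^bsub>H\<^esub> h \<otimes>\<^bsub>G\<^esub> h = \<one>\<^bsub>G\<^esub>"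
    using H_mult[of "inv\<^bsub>H\<^esub> h" h] assms H_one by simp
qed (use assms in \<open>auto intro: H_subset\<close>)

lemma H_inclusion_smooth: "smooth_map (atlas H) (atlas G) (\<lambda>x. x)"
  using H(1) unfolding lie_subgroup_def immersion_def by blast

lemma phip_action: "right_lie_action G (atlas Gs) phip"
  and phim_action: "left_lie_action Gs (atlas G) phim"
  using dressing unfolding dressing_actions_def by blast+

lemma phip_smooth: "smooth_map (prod_atlas (atlas G) (atlas Gs)) (atlas Gs) (\<lambda>(x, u). phip x u)"
  and phim_smooth: "smooth_map (prod_atlas (atlas Gs) (atlas G)) (atlas G) (\<lambda>(u, x). phim u x)"
  using phip_action phim_action unfolding right_lie_action_def left_lie_action_def by blast+

lemma phip_closed: "x \<in> carrier G \<Longrightarrow> u \<in> carrier Gs \<Longrightarrow> phip x u \<in> carrier Gs"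
  using smooth_map_carrier[OF phip_smooth, of "(x, u)"]
  by (simp add: mcarrier_prod lie_groupD(3)[OF G(1)] lie_groupD(3)[OF lie_group_Gs])

lemma phim_closed: "u \<in> carrier Gs \<Longrightarrow> x \<in> carrier G \<Longrightarrow> phim u x \<in> carrier G"
  using smooth_map_carrier[OF phim_smooth, of "(u, x)"]
  by (simp add: mcarrier_prod lie_groupD(3)[OF G(1)] lie_groupD(3)[OF lie_group_Gs])

lemma phip_compose:
  "x \<in> carrier G \<Longrightarrow> y \<in> carrier G \<Longrightarrow> u \<in> carrier Gs \<Longrightarrow> phip (x \<otimes>\<^bsub>G\<^esub> y) u = phip y (phip x u)"
  using phip_action lie_groupD(3)[OF lie_group_Gs] unfolding right_lie_action_def by blast

lemma phip_one: "u \<in> carrier Gs \<Longrightarrow> phip \<one>\<^bsub>G\<^esub> u = u"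
  using phip_action lie_groupD(3)[OF lie_group_Gs] unfolding right_lie_action_def by blast

lemma phim_compose:
  "u \<in> carrier Gs \<Longrightarrow> v \<in> carrier Gs \<Longrightarrow> x \<in> carrier G \<Longrightarrow> phim (u \<otimes>\<^bsub>Gs\<^esub> v) x = phim u (phim v x)"
  using phim_action lie_groupD(3)[OF G(1)] unfolding left_lie_action_def by blast

lemma phim_one: "x \<in> carrier G \<Longrightarrow> phim \<one>\<^bsub>Gs\<^esub> x = x"
  using phim_action lie_groupD(3)[OF G(1)] unfolding left_lie_action_def by blast

text \<open>
  By the twisted product rule the image of the unit is idempotent.
\<close>

lemma phip_unit:
  assumes x: "x \<in> carrier G"
  shows "phip x \<one>\<^bsub>Gs\<^esub> = \<one>\<^bsub>Gs\<^esub>"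
proof -
  have c: "phip x \<one>\<^bsub>Gs\<^esub> \<in> carrier Gs" using phip_closed[OF x] by simp
  have "phip x (\<one>\<^bsub>Gs\<^esub> \<otimes>\<^bsub>Gs\<^esub> \<one>\<^bsub>Gs\<^esub>) = phip (phim \<one>\<^bsub>Gs\<^esub> x) \<one>\<^bsub>Gs\<^esub> \<otimes>\<^bsub>Gs\<^esub> phip x \<one>\<^bsub>Gs\<^esub>"
    by (rule phip_mult[OF x]) simp_all
  hence "phip x \<one>\<^bsub>Gs\<^esub> = phip x \<one>\<^bsub>Gs\<^esub> \<otimes>\<^bsub>Gs\<^esub> phip x \<one>\<^bsub>Gs\<^esub>"
    by (simp add: phim_one[OF x])
  thus ?thesis using Gs.r_cancel_one[OF c c] by metis
qed

text \<open>
  The dressing action of \<open>G\<^sup>*\<close> on \<open>G\<close> is equivariant for translations by \<open>H\<close> on both sides, up to the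
  twist of the acting element by \<open>\<phi>\<^sup>+\<close> of \<open>h\<^sup>-\<^sup>1\<close>.  The left factor \<open>h\<close> is fixed and moves the twisted
  element back to \<open>v\<close>; the right factor \<open>k\<close> is fixed whatever acts on it.
\<close>

lemma phim_biequivariant:
  assumes v: "v \<in> carrier Gs" and h: "h \<in> carrier H" and m: "m \<in> carrier G" and k: "k \<in> carrier H"
  shows "phim (phip (inv\<^bsub>G\<^esub> h) v) (h \<otimes>\<^bsub>G\<^esub> m \<otimes>\<^bsub>G\<^esub> k) = h \<otimes>\<^bsub>G\<^esub> phim v m \<otimes>\<^bsub>G\<^esub> k"
proof -
  let ?w = "phip (inv\<^bsub>G\<^esub> h) v"
  have hG: "h \<in> carrier G" and kG: "k \<in> carrier G" using h k H_subset by auto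
  have w: "?w \<in> carrier Gs" using phip_closed v hG by simp
  have hw: "phip h ?w = v"
    using phip_compose[of "inv\<^bsub>G\<^esub> h" h v] hG v phip_one[OF v] by simp
  have "phim ?w (h \<otimes>\<^bsub>G\<^esub> m \<otimes>\<^bsub>G\<^esub> k) = phim ?w (h \<otimes>\<^bsub>G\<^esub> (m \<otimes>\<^bsub>G\<^esub> k))"
    using hG m kG by (simp add: G.m_assoc)
  also have "\<dots> = h \<otimes>\<^bsub>G\<^esub> phim v (m \<otimes>\<^bsub>G\<^esub> k)"
    using phim_mult[OF w hG, of "m \<otimes>\<^bsub>G\<^esub> k"] phim_H[OF w h] hw m kG by simp
  also have "phim v (m \<otimes>\<^bsub>G\<^esub> k) = phim v m \<otimes>\<^bsub>G\<^esub> k"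
    using phim_mult[OF v m kG] phim_H[OF phip_closed[OF m v] k] by simp
  finally show ?thesis
    using hG kG phim_closed[OF v m] by (simp add: G.m_assoc)
qed

text \<open>
  In the twisted product rule, the element acting on \<open>u\<close> is computed by \<open>phim_biequivariant\<close>, while on the
  second factor the leading \<open>h\<close> cancels against \<open>h\<^sup>-\<^sup>1\<close> because \<open>\<phi>\<^sup>+\<close> is a right action.
\<close>

lemma phip_biequivariant:
  assumes u: "u \<in> carrier Gs" and v: "v \<in> carrier Gs"
    and h: "h \<in> carrier H" and m: "m \<in> carrier G" and k: "k \<in> carrier H"
  shows "phip (h \<otimes>\<^bsub>G\<^esub> m \<otimes>\<^bsub>G\<^esub> k) (u \<otimes>\<^bsub>Gs\<^esub> phip (inv\<^bsub>G\<^esub> h) v) =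
    phip (h \<otimes>\<^bsub>G\<^esub> phim v m \<otimes>\<^bsub>G\<^esub> k) u \<otimes>\<^bsub>Gs\<^esub> phip k (phip m v)"
proof -
  let ?w = "phip (inv\<^bsub>G\<^esub> h) v" and ?x = "h \<otimes>\<^bsub>G\<^esub> m \<otimes>\<^bsub>G\<^esub> k"
  have hG: "h \<in> carrier G" and kG: "k \<in> carrier G" using h k H_subset by auto
  have x: "?x \<in> carrier G" using hG m kG by simp
  have w: "?w \<in> carrier Gs" using phip_closed v hG by simp
  have "inv\<^bsub>G\<^esub> h \<otimes>\<^bsub>G\<^esub> ?x = m \<otimes>\<^bsub>G\<^esub> k"
    using hG m kG by (simp add: G.m_assoc[symmetric])
  hence "phip ?x ?w = phip k (phip m v)"
    using phip_compose[of "inv\<^bsub>G\<^esub> h" ?x v] phip_compose[OF m kG v] hG x v by simp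
  thus ?thesis
    using phip_mult[OF x u w] phim_biequivariant[OF v h m k] by simp
qed

lemma Istar_mult: "u \<in> carrier Gs \<Longrightarrow> v \<in> carrier Gs \<Longrightarrow> Istar (u \<otimes>\<^bsub>Gs\<^esub> v) = Istar u + Istar v"
  using Istar_morphism hom_mult[of Istar Gs vector_liegrp u v]
  unfolding lie_morphism_def vector_liegrp_def by simp

lemma Istar_one: "Istar \<one>\<^bsub>Gs\<^esub> = 0"
  using Istar_mult[of "\<one>\<^bsub>Gs\<^esub>" "\<one>\<^bsub>Gs\<^esub>"] by simp

lemma Istar_smooth: "smooth_map (atlas Gs) vec_atlas Istar"
  using Istar_morphism unfolding lie_morphism_def vector_liegrp_def by simp

end

section \<open>The groupoid action\<close>

context poisson_lie_setting
begin

abbreviation "Xstar_e \<equiv> groupoid_times_group (Xstar_groupoid H Gs phip Istar) H"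
text \<open>
  The type annotation ties the otherwise unconstrained base of \<open>X_groupoid G\<close> to the dual of the Lie
  algebra of \<open>H\<close>.
\<close>

abbreviation X :: "('h dual \<times> 'a \<times> 'h dual, 'h dual \<times> 'g \<times> 'h dual, 'h dual, 'h dual) groupoid" where
  "X \<equiv> X_groupoid G"
abbreviation "Psi \<equiv> Psi_minus G H phip phim Istar"

lemma mcarrier_Xstar_e:
  "((h, p, u), k) \<in> mcarrier (arrows Xstar_e) \<longleftrightarrow> h \<in> carrier H \<and> u \<in> carrier Gs \<and> k \<in> carrier H"
  by (auto simp: groupoid_times_group_def Xstar_groupoid_def mcarrier_prod mcarrier_vec
      lie_groupD(3)[OF lie_group_H] lie_groupD(3)[OF lie_group_Gs])

lemma mcarrier_X: "(p, g, q) \<in> mcarrier (arrows X) \<longleftrightarrow> g \<in> carrier G"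
  by (auto simp: X_groupoid_def mcarrier_prod mcarrier_vec lie_groupD(3)[OF G(1)])

lemma findim_H_dual: "findim_atlas (vec_atlas :: ('h dual, 'h dual) atlas)"
  by (rule findim_atlas_vec[OF finite_dimensional_dual[OF lie_group_findim[OF lie_group_H]]])

text \<open>
  Smoothness on the whole product, of which the fibre product is a subset: \<open>\<Psi>\<^sup>-\<close> is built from smooth
  operations on the components of its arguments.
\<close>

lemma Psi_smooth:
  "smooth_map (prod_atlas (arrows Xstar_e) (arrows X)) (arrows X) (\<lambda>(x, s). Psi x s)"
proof -
  note aH = lie_groupD(2)[OF lie_group_H] and aG = lie_groupD(2)[OF G(1)]
    and aS = lie_groupD(2)[OF lie_group_Gs] and V = findim_H_dual
  note fd = finite_dimensional_dual[OF lie_group_findim[OF lie_group_H]]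
  note VS = findim_atlas_prod[OF V aS]
  note HVS = findim_atlas_prod[OF aH VS]
  note E = findim_atlas_prod[OF HVS aH]
  note GV = findim_atlas_prod[OF aG V]
  note P = findim_atlas_prod[OF V GV]
  note A = findim_atlas_prod[OF E P]
  let ?V = "vec_atlas :: ('h dual, 'h dual) atlas"
  let ?E = "prod_atlas (prod_atlas (atlas H) (prod_atlas ?V (atlas Gs))) (atlas H)"
  let ?P = "prod_atlas ?V (prod_atlas (atlas G) ?V)"
  let ?A = "prod_atlas ?E ?P"
  have arr: "arrows Xstar_e = ?E" "arrows X = ?P"
    unfolding groupoid_times_group_def Xstar_groupoid_def X_groupoid_def by simp_all
  note x = smooth_map_fst[OF E P] and s = smooth_map_snd[OF E P]
  note hpu = smooth_map_fst_of[OF A HVS aH x] and k = smooth_map_snd_of[OF A HVS aH x]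
  note h = smooth_map_fst_of[OF A aH VS hpu] and pu = smooth_map_snd_of[OF A aH VS hpu]
  note p = smooth_map_fst_of[OF A V aS pu] and u = smooth_map_snd_of[OF A V aS pu]
  note gq = smooth_map_snd_of[OF A V GV s]
  note g = smooth_map_fst_of[OF A aG V gq] and q = smooth_map_snd_of[OF A aG V gq]
  let ?h = "\<lambda>z. fst (fst (fst z))" and ?p = "\<lambda>z. fst (snd (fst (fst z)))"
    and ?u = "\<lambda>z. snd (snd (fst (fst z)))" and ?k = "\<lambda>z. snd (fst z)"
    and ?g = "\<lambda>z. fst (snd (snd z))" and ?q = "\<lambda>z. snd (snd (snd z))"
  let ?m = "\<lambda>z. ?h z \<otimes>\<^bsub>G\<^esub> ?g z \<otimes>\<^bsub>G\<^esub> inv\<^bsub>G\<^esub> (?k z)"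
  have incl: "smooth_map ?A (atlas G) j" if "smooth_map ?A (atlas H) j" for j
    by (rule smooth_map_compose[where F = j and G = "\<lambda>x. x", OF A aH aG that H_inclusion_smooth])
  have m: "smooth_map ?A (atlas G) ?m"
    by (intro smooth_map_mult[OF G(1) A] smooth_map_inv[OF G(1) A] incl[OF h] incl[OF k] g)
  have Ad: "smooth_map ?A vec_atlas (\<lambda>z. Ad_star H (inv\<^bsub>H\<^esub> (j z)) (r z))"
    if "smooth_map ?A (atlas H) j" "smooth_map ?A vec_atlas r" for j r
    by (rule Ad_star_smooth[OF lie_group_H A smooth_map_inv[OF lie_group_H A that(1)] that(2)])
  have I: "smooth_map ?A vec_atlas (\<lambda>z. Istar (w z))" if "smooth_map ?A (atlas Gs) w" for w
    by (rule smooth_map_compose[where F = w and G = Istar, OF A aS V that Istar_smooth])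
  have 1: "smooth_map ?A vec_atlas (\<lambda>z. Ad_star H (inv\<^bsub>H\<^esub> (?h z)) (?p z) + Istar (?u z))"
    by (rule smooth_map_add[OF A fd Ad[OF h p] I[OF u]])
  have 2: "smooth_map ?A (atlas G) (\<lambda>z. phim (?u z) (?m z))"
    by (rule smooth_map_compose2[where F = ?u and G = ?m, OF A aS aG aG phim_smooth u m])
  have "smooth_map ?A (atlas Gs) (\<lambda>z. phip (?m z) (?u z))"
    by (rule smooth_map_compose2[where F = ?m and G = ?u, OF A aG aS aS phip_smooth m u])
  hence 3: "smooth_map ?A vec_atlas
      (\<lambda>z. Ad_star H (inv\<^bsub>H\<^esub> (?k z)) (?q z) + Istar (phip (?m z) (?u z)))"
    by (rule smooth_map_add[OF A fd Ad[OF k q] I])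
  have "(\<lambda>(x, s). Psi x s) = (\<lambda>z. (Ad_star H (inv\<^bsub>H\<^esub> (?h z)) (?p z) + Istar (?u z),
      phim (?u z) (?m z), Ad_star H (inv\<^bsub>H\<^esub> (?k z)) (?q z) + Istar (phip (?m z) (?u z))))"
    by (auto simp: Psi_minus_def fun_eq_iff)
  thus ?thesis
    unfolding arr using smooth_map_Pair[OF A V GV 1 smooth_map_Pair[OF A aG V 2 3]] by simp
qed

lemma Psi_moment:
  "tgt X (Psi ((h, p, u), k) s) = tgt Xstar_e ((h, p, u), k)"
  by (cases s) (simp add: Psi_minus_def X_groupoid_def Xstar_groupoid_def groupoid_times_group_def)

lemma Psi_unit:
  assumes g: "g \<in> carrier G"
  shows "Psi (unit_arrow Xstar_e p) (p', g, q) = (p, g, q)"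
proof -
  have Ad1: "Ad_star H (inv\<^bsub>H\<^esub> \<one>\<^bsub>H\<^esub>) r = r" for r
    by (simp only: H.inv_one Ad_star_one[OF lie_group_H])
  have m: "\<one>\<^bsub>H\<^esub> \<otimes>\<^bsub>G\<^esub> g \<otimes>\<^bsub>G\<^esub> inv\<^bsub>G\<^esub> \<one>\<^bsub>H\<^esub> = g"
    unfolding H_one using g by simp
  show ?thesis
    using phim_one[OF g] phip_unit[OF g] Istar_one
    unfolding Psi_minus_def Xstar_groupoid_def groupoid_times_group_def
    by (simp add: Ad1 m del: H.inv_one)
qed

text \<open>
  With \<open>m = j g l\<^sup>-\<^sup>1\<close>, the double translate that enters the action of the product arrow is
  \<open>h m k\<^sup>-\<^sup>1\<close>.  The three components then agree by linearity of \<open>Ad\<^sup>*\<close> and equivariance of \<open>I\<^sup>*\<close>,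
  by \<open>phim_biequivariant\<close>, and by \<open>phip_biequivariant\<close>, respectively.
\<close>

lemma Psi_comp:
  assumes h: "h \<in> carrier H" and u: "u \<in> carrier Gs" and k: "k \<in> carrier H"
    and j: "j \<in> carrier H" and v: "v \<in> carrier Gs" and l: "l \<in> carrier H"
    and g: "g \<in> carrier G"
    and composable: "p' = Ad_star H (inv\<^bsub>H\<^esub> j) p + Istar v"
  shows "Psi ((h, p', u), k) (Psi ((j, p, v), l) (p, g, q)) =
    Psi (gcomp Xstar_e ((h, p', u), k) ((j, p, v), l)) (p, g, q)"
proof -
  define m where "m = j \<otimes>\<^bsub>G\<^esub> g \<otimes>\<^bsub>G\<^esub> inv\<^bsub>G\<^esub> l"
  let ?w = "phip (inv\<^bsub>G\<^esub> h) v" and ?k = "inv\<^bsub>G\<^esub> k"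
  note HG = H_subset[OF h] H_subset[OF j] H_subset[OF k] H_subset[OF l]
  have m: "m \<in> carrier G" unfolding m_def using HG g by simp
  have kH: "?k \<in> carrier H" using H.inv_closed[OF k] H_inv[OF k] by simp
  have hH: "inv\<^bsub>G\<^esub> h \<in> carrier H" using H.inv_closed[OF h] H_inv[OF h] by simp
  have w: "?w \<in> carrier Gs" using phip_closed v HG(1) by simp
  have Ad2: "Ad_star H (inv\<^bsub>H\<^esub> (a \<otimes>\<^bsub>H\<^esub> b)) r = Ad_star H (inv\<^bsub>H\<^esub> a) (Ad_star H (inv\<^bsub>H\<^esub> b) r)"
    if "a \<in> carrier H" "b \<in> carrier H" for a b r
    using that by (simp add: H.inv_mult_group Ad_star_mult[OF lie_group_H])
  have x: "(h \<otimes>\<^bsub>H\<^esub> j) \<otimes>\<^bsub>G\<^esub> g \<otimes>\<^bsub>G\<^esub> inv\<^bsub>G\<^esub> (k \<otimes>\<^bsub>H\<^esub> l) = h \<otimes>\<^bsub>G\<^esub> m \<otimes>\<^bsub>G\<^esub> ?k"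
    unfolding m_def H_mult[OF h j] H_mult[OF k l]
    using HG g by (simp add: G.m_assoc G.inv_mult_group)
  have first: "Ad_star H (inv\<^bsub>H\<^esub> (h \<otimes>\<^bsub>H\<^esub> j)) p + Istar (u \<otimes>\<^bsub>Gs\<^esub> ?w) =
      Ad_star H (inv\<^bsub>H\<^esub> h) p' + Istar u"
    unfolding composable Ad2[OF h j] Istar_mult[OF u w] Istar_equivariant[OF hH v]
    using h by (simp add: Ad_star_add[OF lie_group_H] H_inv[OF h, symmetric])
  have second: "phim (u \<otimes>\<^bsub>Gs\<^esub> ?w) (h \<otimes>\<^bsub>G\<^esub> m \<otimes>\<^bsub>G\<^esub> ?k) =
      phim u (h \<otimes>\<^bsub>G\<^esub> phim v m \<otimes>\<^bsub>G\<^esub> ?k)"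
    using phim_compose[OF u w, of "h \<otimes>\<^bsub>G\<^esub> m \<otimes>\<^bsub>G\<^esub> ?k"] HG m
    by (simp add: phim_biequivariant[OF v h m kH])
  have y: "h \<otimes>\<^bsub>G\<^esub> phim v m \<otimes>\<^bsub>G\<^esub> ?k \<in> carrier G" using HG phim_closed[OF v m] by simp
  have third: "Ad_star H (inv\<^bsub>H\<^esub> (k \<otimes>\<^bsub>H\<^esub> l)) q + Istar (phip (h \<otimes>\<^bsub>G\<^esub> m \<otimes>\<^bsub>G\<^esub> ?k) (u \<otimes>\<^bsub>Gs\<^esub> ?w)) =
      Ad_star H (inv\<^bsub>H\<^esub> k) (Ad_star H (inv\<^bsub>H\<^esub> l) q + Istar (phip m v)) +
      Istar (phip (h \<otimes>\<^bsub>G\<^esub> phim v m \<otimes>\<^bsub>G\<^esub> ?k) u)"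
    unfolding Ad2[OF k l] phip_biequivariant[OF u v h m kH]
      Istar_mult[OF phip_closed[OF y u] phip_closed[OF H_subset[OF kH] phip_closed[OF m v]]]
      Istar_equivariant[OF kH phip_closed[OF m v]]
    using k by (simp add: Ad_star_add[OF lie_group_H] H_inv[OF k, symmetric])
  have "gcomp Xstar_e ((h, p', u), k) ((j, p, v), l) =
      ((h \<otimes>\<^bsub>H\<^esub> j, p, u \<otimes>\<^bsub>Gs\<^esub> ?w), k \<otimes>\<^bsub>H\<^esub> l)"
    unfolding Xstar_groupoid_def groupoid_times_group_def by (simp add: H_inv[OF h])
  thus ?thesis
    unfolding Psi_minus_def by (simp add: x first second third m_def[symmetric])
qed

lemma Psi_action: "left_groupoid_action Xstar_e (arrows X) (tgt X) Psi"
  unfolding left_groupoid_action_def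
proof (intro conjI ballI impI)
  have objs: "objects Xstar_e = vec_atlas"
    unfolding groupoid_times_group_def Xstar_groupoid_def by simp
  have J: "tgt X = fst" by (auto simp: X_groupoid_def fun_eq_iff)
  have arr: "arrows X = prod_atlas vec_atlas (prod_atlas (atlas G) vec_atlas)"
    by (simp add: X_groupoid_def)
  show "smooth_map (arrows X) (objects Xstar_e) (tgt X)"
    unfolding objs J arr
    by (rule smooth_map_fst[OF findim_H_dual findim_atlas_prod[OF lie_groupD(2)[OF G(1)] findim_H_dual]])
  let ?A = "prod_atlas (arrows Xstar_e) (arrows X)"
  let ?S = "{(x, s). x \<in> mcarrier (arrows Xstar_e) \<and> s \<in> mcarrier (arrows X) \<and> src Xstar_e x = tgt X s}"
  have sub: "?S \<subseteq> mcarrier ?A" by (auto simp: mcarrier_prod)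
  \<comment> \<open>the formula for \<open>Psi\<close> is its own smooth extension to the whole product manifold\<close>
  have "openin (mtopology ?A) (mcarrier ?A)"
    using openin_topspace[of "mtopology ?A"] by (simp only: topspace_mtopology)
  thus "smooth_map_on ?A (arrows X) ?S (\<lambda>(x, s). Psi x s)"
    using sub Psi_smooth unfolding smooth_map_on_def smooth_map_def by blast
next
  fix x s
  show "tgt X (Psi x s) = tgt Xstar_e x"
    using Psi_moment by (metis prod.exhaust)
next
  fix y x s
  assume y: "y \<in> mcarrier (arrows Xstar_e)" and x: "x \<in> mcarrier (arrows Xstar_e)"
    and s: "s \<in> mcarrier (arrows X)"
    and yx: "src Xstar_e y = tgt Xstar_e x" and xs: "src Xstar_e x = tgt X s"
  obtain h p' u k where Y: "y = ((h, p', u), k)" by (metis prod.exhaust)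
  obtain j p v l where Xx: "x = ((j, p, v), l)" by (metis prod.exhaust)
  obtain r g q where S: "s = (r, g, q)" by (metis prod.exhaust)
  have p': "p' = Ad_star H (inv\<^bsub>H\<^esub> j) p + Istar v"
    using yx unfolding Y Xx by (simp add: groupoid_times_group_def Xstar_groupoid_def)
  have r: "r = p"
    using xs unfolding Xx S by (simp add: groupoid_times_group_def Xstar_groupoid_def X_groupoid_def)
  have "h \<in> carrier H" "u \<in> carrier Gs" "k \<in> carrier H" "j \<in> carrier H" "v \<in> carrier Gs"
    "l \<in> carrier H" "g \<in> carrier G"
    using y x s unfolding Y Xx S mcarrier_Xstar_e mcarrier_X by blast+
  from Psi_comp[OF this p']
  show "Psi y (Psi x s) = Psi (gcomp Xstar_e y x) s"
    unfolding Y Xx S r .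
next
  fix s assume s: "s \<in> mcarrier (arrows X)"
  obtain p g q where S: "s = (p, g, q)" by (metis prod.exhaust)
  have g: "g \<in> carrier G" using s unfolding S mcarrier_X .
  show "Psi (unit_arrow Xstar_e (tgt X s)) s = s"
    using Psi_unit[OF g, of p p q] unfolding S by (simp add: X_groupoid_def)
qed

end

theorem proposition5p2p5:
  fixes G :: "('a, 'g::real_normed_vector) liegrp"
    and H :: "('a, 'h::real_normed_vector) liegrp"
    and R :: "'g dual \<Rightarrow> 'g"
    and Gs :: "('b, 'g dual) liegrp"
    and brs :: "'b fun_bracket"
    and phip :: "'a \<Rightarrow> 'b \<Rightarrow> 'b"
    and phim :: "'b \<Rightarrow> 'a \<Rightarrow> 'a"
    and \<iota> :: "'h \<Rightarrow> 'g"
    and Istar :: "'b \<Rightarrow> 'h dual"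
  assumes "poisson_lie_setting G H R Gs brs phip phim \<iota> Istar"
  shows
    "left_groupoid_action
       (groupoid_times_group (Xstar_groupoid H Gs phip Istar) H)
       (arrows (X_groupoid G)) (tgt (X_groupoid G)) (Psi_minus G H phip phim Istar) \<and>
     (\<forall>h p u g q. (h, p, u) \<in> mcarrier (arrows (Xstar_groupoid H Gs phip Istar)) \<longrightarrow>
        (p, g, q) \<in> mcarrier (arrows (X_groupoid G)) \<longrightarrow>
        Psi_minus G H phip phim Istar ((h, p, u), h) (p, g, q) =
          psi_minus G H phip phim Istar (h, p, u) (p, g, q))"
proof (intro conjI allI impI)
  interpret poisson_lie_setting G H R Gs brs phip phim \<iota> Istar by fact
  show "left_groupoid_action
       (groupoid_times_group (Xstar_groupoid H Gs phip Istar) H)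
       (arrows (X_groupoid G)) (tgt (X_groupoid G)) (Psi_minus G H phip phim Istar)"
    by (rule Psi_action)
qed (simp add: Psi_minus_def psi_minus_def)

end
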